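(* Let $\mathbb{F}$ be a finite field of odd order $q$, and let $\theta$ be a non-trivial additive character of $\mathbb{F}$. For $n\ge 0$ let $\varPhi_n$ be the canonical matrix of the pair $(\operatorname{Alt}_n(\mathbb{F}),\operatorname{GL}_n(\mathbb{F}))$. Then for all integers $N\ge 0$ and $0\le x,y\le N$, $$\varPhi_{2N}(2y,2x)=(-1)^xq^{x(x-1)}(q^{2N-1};q^{-2})_x\begin{bmatrix} N \\ x \end{bmatrix}_{q^2}K^{\mathrm{Aff}}_y(x;q^{-2N+1},N;q^2),$$ and $$\varPhi_{2N+1}(2y,2x)=(-1)^xq^{x(x-1)}(q^{2N+1};q^{-2})_x\begin{bmatrix} N \\ x \end{bmatrix}_{q^2}K^{\mathrm{Aff}}_y(x;q^{-2N-1},N;q^2).$$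
   Context: $\operatorname{Alt}_n(\mathbb{F})$ is the additive group of $n\times n$ alternating (skew-symmetric) matrices over $\mathbb{F}$ (zero for $n=0,1$, with $\varPhi_n(0,0)=1$). $\operatorname{GL}_n(\mathbb{F})$ acts by $\rho(g)a=ga\,{}^tg$; its orbits are the sets of alternating matrices of rank $r$, $0\le r\le n$, $r$ even. With $\langle a|b\rangle=\operatorname{trace}({}^tab)$ and $\theta_a(b)=\theta(\langle a|b\rangle)$, the orbits on the character group are $\{\theta_a:\operatorname{rank}a=s\}$, $0\le s\le n$, $s$ even. The canonical matrix is, for even $s,r$ in $[0,n]$, $$\varPhi_n(s,r)=\sum_{b\in\operatorname{Alt}_n(\mathbb{F}),\ \operatorname{rank}b=r}\overline{\theta(\langle a|b\rangle)},\qquad a\in\operatorname{Alt}_n(\mathbb{F})\text{ any matrix with }\operatorname{rank}a=s$$ (independent of the choice of $a$). Notation: $(a;q)_k=(1-a)(1-aq)\cdots(1-aq^{k-1})$, $(a;q)_0=1$; Gaussian polynomial $\begin{bmatrix} N \\ x \end{bmatrix}_q=\dfrac{(q^N;q^{-1})_x}{(q;q)_x}$. Affine $q$-Krawtchouk polynomial: for integers $0\le y\le N$, $$K^{\mathrm{Aff}}_y(x;a,N;q)=\sum_{k=0}^{y}\frac{(q^{-y};q)_k\,(q^{-x};q)_k}{(q^{-N};q)_k\,(a;q)_k\,(q;q)_k}\,q^k;$$ in the claim these are used with $q$ replaced by $q^2$. *)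

theory Defs
  imports "HOL-Library.Cardinality" "Jordan_Normal_Form.DL_Rank"
begin

definition nontrivial_additive_character :: "('a::ring_1 \<Rightarrow> complex) \<Rightarrow> bool" where
  "nontrivial_additive_character \<theta> \<longleftrightarrow>
     (\<forall>u v. \<theta> (u + v) = \<theta> u * \<theta> v) \<and> (\<forall>u. \<theta> u \<noteq> 0) \<and> (\<exists>u. \<theta> u \<noteq> 1)"

text \<open>The condition on the diagonal follows from skew-symmetry when \<open>2 \<noteq> 0\<close>.\<close>

definition alternating_mats :: "nat \<Rightarrow> 'a::field mat set" where
  "alternating_mats n =
     {A \<in> carrier_mat n n. transpose_mat A = - A \<and> (\<forall>i<n. A $$ (i, i) = 0)}"

definition alternating_mats_of_rank :: "nat \<Rightarrow> nat \<Rightarrow> 'a::field mat set" where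
  "alternating_mats_of_rank n r = {A \<in> alternating_mats n. vec_space.rank n A = r}"

definition mat_trace :: "'a::comm_monoid_add mat \<Rightarrow> 'a" where
  "mat_trace A = (\<Sum>i<dim_row A. A $$ (i, i))"

definition trace_form :: "'a::comm_ring_1 mat \<Rightarrow> 'a mat \<Rightarrow> 'a" where
  "trace_form A B = mat_trace (transpose_mat A * B)"

text \<open>
  The congruence action \<open>g \<cdot> A = g A g\<^sup>T\<close> of the general linear group on the alternating matrices
  has the sets \<open>alternating_mats_of_rank n r\<close> with \<open>r\<close> even as its orbits, and the characters
  \<open>\<lambda>B. \<theta> (trace_form A B)\<close>, grouped by the rank \<open>s\<close> of \<open>A\<close>, as its orbits on the character group.
  Rows of the canonical matrix are indexed by \<open>s\<close>, columns by \<open>r\<close>. The entry is the common value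
  of the character sum for all \<open>A\<close> of rank \<open>s\<close>; the definite description specifies a value only
  if such \<open>A\<close> exist and the sum does not depend on \<open>A\<close>.
\<close>

definition canonical_matrix_Alt ::
    "('a::field \<Rightarrow> complex) \<Rightarrow> nat \<Rightarrow> nat \<Rightarrow> nat \<Rightarrow> complex" where
  "canonical_matrix_Alt \<theta> n s r =
     (THE z. \<forall>A \<in> alternating_mats_of_rank n s.
        z = (\<Sum>B \<in> alternating_mats_of_rank n r. cnj (\<theta> (trace_form A B))))"

definition q_pochhammer :: "'b::comm_ring_1 \<Rightarrow> 'b \<Rightarrow> nat \<Rightarrow> 'b" where
  "q_pochhammer a q k = (\<Prod>i<k. 1 - a * q ^ i)"

definition gaussian_poly :: "nat \<Rightarrow> nat \<Rightarrow> 'b::field \<Rightarrow> 'b" where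
  "gaussian_poly N x q = q_pochhammer (q ^ N) (inverse q) x / q_pochhammer q q x"

definition affine_q_krawtchouk :: "nat \<Rightarrow> nat \<Rightarrow> 'b::field \<Rightarrow> nat \<Rightarrow> 'b \<Rightarrow> 'b" where
  "affine_q_krawtchouk y x a N q =
     (\<Sum>k\<le>y. q_pochhammer (q powi (- int y)) q k * q_pochhammer (q powi (- int x)) q k /
        (q_pochhammer (q powi (- int N)) q k * q_pochhammer a q k * q_pochhammer q q k) * q ^ k)"

end

theory Submission
  imports Defs "Jordan_Normal_Form.Schur_Decomposition"
begin

text \<open>
  Write an alternating matrix of size \<open>n + 1\<close> as an alternating matrix \<open>B\<close> of size \<open>n\<close> bordered by a
  vector \<open>b\<close>. Its rank is \<open>rank B\<close> if \<open>b\<close> is in the range of \<open>B\<close>, and \<open>rank B + 2\<close> otherwise. Summing the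
  character over \<open>b\<close> first therefore leaves only sums over those \<open>B\<close> that annihilate the bordering
  vector \<open>a\<close> of the argument \<open>A\<close>. With \<open>\<phi>(n, y, x)\<close> for the sum over rank \<open>2x\<close> at an \<open>A\<close> of rank \<open>2y\<close>,
  the case \<open>a = 0\<close> gives
  \<open>\<phi>(n + 1, 0, x) = q\<^sup>2\<^sup>x \<phi>(n, 0, x) + (q\<^sup>n - q\<^sup>2\<^sup>x\<^sup>-\<^sup>2) \<phi>(n, 0, x - 1)\<close>, and the case where \<open>a\<close> is the first
  unit vector, to which every nonzero \<open>A\<close> reduces by congruence, gives
  \<open>\<phi>(n + 2, y + 1, x) = q\<^sup>2\<^sup>x \<phi>(n, y, x) - q\<^sup>2\<^sup>x\<^sup>-\<^sup>2 \<phi>(n, y, x - 1)\<close>.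
  These recursions determine \<open>\<phi>\<close>. They imply
  \<open>\<phi>(n, y + 1, x) = \<phi>(n, y, x) - q\<^sup>2\<^sup>n\<^sup>-\<^sup>2\<^sup>y\<^sup>-\<^sup>3 \<phi>(n - 2, y, x - 1)\<close>, which the Krawtchouk expression
  satisfies term by term.
\<close>

subsection \<open>Recursions for the affine q-Krawtchouk polynomials\<close>

text \<open>The number of alternating \<open>n \<times> n\<close> matrices of rank \<open>2 * x\<close>, as a polynomial in \<open>X = q ^ n\<close>.\<close>

definition alt_count :: "'b::field \<Rightarrow> 'b \<Rightarrow> nat \<Rightarrow> 'b" where
  "alt_count q X x = (\<Prod>i<2 * x. X - q ^ i) / (q ^ x\<^sup>2 * (\<Prod>i<x. q ^ (2 * Suc i) - 1))"

lemma alt_count_0 [simp]: "alt_count q X 0 = 1"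
  by (simp add: alt_count_def)

text \<open>
  The character sum at a matrix of rank \<open>2 * y\<close>, again with \<open>X = q ^ n\<close>. The recursion in \<open>y\<close> is the
  one that the affine \<open>q\<close>-Krawtchouk sum visibly satisfies; the recursion coming from matrices is
  \<open>alt_sum_Suc\<close> below.
\<close>

fun alt_sum :: "'b::field \<Rightarrow> nat \<Rightarrow> 'b \<Rightarrow> nat \<Rightarrow> 'b" where
  "alt_sum q 0 X x = alt_count q X x"
| "alt_sum q (Suc y) X 0 = alt_sum q y X 0"
| "alt_sum q (Suc y) X (Suc x) = alt_sum q y X (Suc x) - X\<^sup>2 / q ^ (2 * y + 3) * alt_sum q y (X / q\<^sup>2) x"

lemma alt_sum_0_right [simp]: "alt_sum q y X 0 = 1"
  by (induction y) auto

lemma q_pochhammer_0 [simp]: "q_pochhammer a q 0 = 1"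
  by (simp add: q_pochhammer_def)

lemma q_pochhammer_Suc: "q_pochhammer a q (Suc k) = q_pochhammer a q k * (1 - a * q ^ k)"
  by (simp add: q_pochhammer_def)

lemma q_pochhammer_Suc_left:
  "a * q = b \<Longrightarrow> q_pochhammer a q (Suc k) = (1 - a) * q_pochhammer b q k"
  by (auto simp add: q_pochhammer_def prod.lessThan_Suc_shift mult_ac simp del: prod.lessThan_Suc)

lemma gaussian_poly_Suc_Suc:
  assumes "q \<noteq> (0 :: 'b::field)"
  shows "gaussian_poly (Suc N) (Suc x) q = (1 - q ^ Suc N) / (1 - q ^ Suc x) * gaussian_poly N x q"
proof -
  have "q_pochhammer (q ^ Suc N) (inverse q) (Suc x) = (1 - q ^ Suc N) * q_pochhammer (q ^ N) (inverse q) x"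
    by (rule q_pochhammer_Suc_left) (use assms in simp)
  moreover have "q_pochhammer q q (Suc x) = (1 - q ^ Suc x) * q_pochhammer q q x"
    by (simp add: q_pochhammer_Suc)
  ultimately show ?thesis by (simp add: gaussian_poly_def)
qed

text \<open>
  The part of the \<open>k\<close>-th summand that does not depend on \<open>y\<close>, multiplied by the prefactor of the
  Krawtchouk polynomial. \<open>Y\<close> stands for \<open>q ^ (2 * N - 1)\<close> or \<open>q ^ (2 * N + 1)\<close>.
\<close>

definition krawtchouk_term :: "'b::field \<Rightarrow> nat \<Rightarrow> 'b \<Rightarrow> nat \<Rightarrow> nat \<Rightarrow> 'b" where
  "krawtchouk_term q N Y x k =
     (-1) ^ x * q ^ (x * (x - 1)) * q_pochhammer Y (inverse (q\<^sup>2)) x * gaussian_poly N x (q\<^sup>2) *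
     (q_pochhammer (inverse (q\<^sup>2) ^ x) (q\<^sup>2) k /
       (q_pochhammer (inverse (q\<^sup>2) ^ N) (q\<^sup>2) k * q_pochhammer (inverse Y) (q\<^sup>2) k *
         q_pochhammer (q\<^sup>2) (q\<^sup>2) k) * (q\<^sup>2) ^ k)"

context
  fixes q :: "'b::field"
  assumes q0: "q \<noteq> 0" and q1: "\<And>k. k > 0 \<Longrightarrow> q ^ k \<noteq> 1"
begin

lemma alt_count_Suc_right:
  "alt_count q X (Suc x) =
     (X - q ^ (2 * x)) * (X - q ^ (2 * x + 1)) * alt_count q X x
       / (q ^ (2 * x + 1) * (q ^ (2 * x + 2) - 1))"
proof -
  have e: "(Suc x)\<^sup>2 = x\<^sup>2 + (2 * x + 1)" by (simp add: power2_eq_square)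
  show ?thesis unfolding alt_count_def e power_add[of q "x\<^sup>2"]
    by (simp add: mult_ac)
qed

text \<open>The two lowest factors of the product are split off. The others satisfy
  \<open>X - q ^ (i + 2) = q\<^sup>2 * (X / q\<^sup>2 - q ^ i)\<close>, so what remains is the count
  for size \<open>n - 2\<close>.\<close>

lemma alt_count_Suc_left:
  "alt_count q X (Suc x) =
     q ^ (2 * x) * (X - 1) * (X - q) * alt_count q (X / q\<^sup>2) x / (q * (q ^ (2 * x + 2) - 1))"
proof -
  have e: "(Suc x)\<^sup>2 = x\<^sup>2 + (2 * x + 1)" by (simp add: power2_eq_square)
  have "(\<Prod>i<2 * x. X - q ^ Suc (Suc i)) = (\<Prod>i<2 * x. q\<^sup>2 * (X / q\<^sup>2 - q ^ i))"
    by (rule prod.cong) (use q0 in \<open>auto simp: field_simps power2_eq_square\<close>)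
  also have "\<dots> = q ^ (4 * x) * (\<Prod>i<2 * x. X / q\<^sup>2 - q ^ i)"
    by (simp add: prod.distrib power_mult[symmetric])
  finally have p: "(\<Prod>i<2 * Suc x. X - q ^ i) = (X - 1) * (X - q) * q ^ (4 * x) * (\<Prod>i<2 * x. X / q\<^sup>2 - q ^ i)"
    by (simp add: prod.lessThan_Suc_shift del: prod.lessThan_Suc power_Suc)
  have f: "q ^ (4 * x) = q ^ (2 * x) * q ^ (2 * x)" by (simp flip: power_add)
  show ?thesis unfolding alt_count_def e power_add[of q "x\<^sup>2"] p f
    using q0 by (simp add: mult_ac)
qed

text \<open>The passage from size \<open>n\<close> to \<open>n + 1\<close>, matching the border
  \<open>a = 0\<close>. All factors of the left product except \<open>q * X - 1\<close> are
  \<open>q\<close> times a factor \<open>X - q ^ i\<close>, so both sides share the product for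
  \<open>x\<close>.\<close>

lemma alt_count_mult:
  "alt_count q (q * X) (Suc x) =
     q ^ (2 * x + 2) * alt_count q X (Suc x) + (X - q ^ (2 * x)) * alt_count q X x"
proof -
  have e: "(Suc x)\<^sup>2 = x\<^sup>2 + (2 * x + 1)" by (simp add: power2_eq_square)
  have "(\<Prod>i<2 * x + 1. q * X - q ^ Suc i) = (\<Prod>i<2 * x + 1. q * (X - q ^ i))"
    by (rule prod.cong) (auto simp: algebra_simps)
  also have "\<dots> = q ^ (2 * x + 1) * (\<Prod>i<2 * x + 1. X - q ^ i)"
    by (simp only: prod.distrib prod_constant card_lessThan)
  finally have p: "(\<Prod>i<2 * Suc x. q * X - q ^ i) =
      (q * X - 1) * (q ^ (2 * x + 1) * ((X - q ^ (2 * x)) * (\<Prod>i<2 * x. X - q ^ i)))"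
    using prod.lessThan_Suc_shift[of "\<lambda>i. q * X - q ^ i" "2 * x + 1"] by (simp add: mult_ac)
  define P where "P = (\<Prod>i<2 * x. X - q ^ i)"
  define D where "D = q ^ x\<^sup>2 * (\<Prod>i<x. q ^ (2 * Suc i) - 1)"
  define z where "z = q ^ (2 * x)"
  have z: "q ^ (2 * x + 1) = z * q" "q ^ (2 * x + 2) = z * q * q" "q ^ (2 * Suc x) = z * q * q" "z \<noteq> 0"
    using q0 by (simp_all add: z_def)
  have z1: "z * q * q \<noteq> 1" using q1[of "2 * x + 2"] unfolding z(2) by simp
  have D: "D \<noteq> 0" unfolding D_def using q0 q1 by (auto simp del: mult_Suc_right)
  have "alt_count q (q * X) (Suc x) = (q * X - 1) * (z * q * ((X - z) * P)) / (D * (z * q * (z * q * q - 1)))"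
    unfolding alt_count_def p unfolding e power_add[of q "x\<^sup>2"] prod.lessThan_Suc z
    by (simp add: P_def D_def z_def mult_ac)
  also have "\<dots> = (q * X - 1) * ((X - z) * P) / (D * (z * q * q - 1))"
  proof -
    have "(q * X - 1) * (z * q * ((X - z) * P)) / (D * (z * q * (z * q * q - 1))) =
        (z * q) * ((q * X - 1) * ((X - z) * P)) / ((z * q) * (D * (z * q * q - 1)))"
      by (simp only: mult_ac)
    also have "\<dots> = (q * X - 1) * ((X - z) * P) / (D * (z * q * q - 1))"
      by (rule mult_divide_mult_cancel_left) (use z q0 in simp)
    finally show ?thesis .
  qed
  also have "\<dots> = z * q * q * ((X - z) * (X - z * q) * (P / D) / (z * q * (z * q * q - 1))) + (X - z) * (P / D)"
    using z z1 q0 D by (simp add: divide_simps) (simp add: algebra_simps)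
  also have "\<dots> = q ^ (2 * x + 2) * alt_count q X (Suc x) + (X - q ^ (2 * x)) * alt_count q X x"
    unfolding alt_count_Suc_right z unfolding alt_count_def P_def D_def z_def by simp
  finally show ?thesis .
qed

text \<open>The term \<open>q * X\<^sup>2\<close> is exactly the coefficient that
  \<open>alt_sum\<close> subtracts at \<open>q\<^sup>2 * X\<close> in the step from
  \<open>y = 0\<close>, which makes this the base case of \<open>alt_sum_Suc\<close>.\<close>

lemma alt_count_mult2:
  "alt_count q (q\<^sup>2 * X) (Suc x) =
     q ^ (2 * x + 2) * alt_count q X (Suc x) + (q * X\<^sup>2 - q ^ (2 * x)) * alt_count q X x"
proof -
  have z: "q ^ (2 * x + 1) = q ^ (2 * x) * q" "q ^ (2 * x + 2) = q ^ (2 * x) * q * q" by simp_all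
  have z1: "q ^ (2 * x) * q * q \<noteq> 1" using q1[of "2 * x + 2"] by (simp add: mult_ac)
  have zn: "q ^ (2 * x) \<noteq> 0" using q0 by simp
  have "alt_count q (q\<^sup>2 * X) (Suc x) =
      q ^ (2 * x) * (q\<^sup>2 * X - 1) * (q\<^sup>2 * X - q) * alt_count q X x / (q * (q ^ (2 * x) * q * q - 1))"
    unfolding alt_count_Suc_left z using q0 by simp
  then show ?thesis unfolding alt_count_Suc_right z using z1 zn q0
    by (simp add: divide_simps) (simp add: algebra_simps power2_eq_square)
qed

text \<open>The two recursions are compatible: replacing \<open>X\<close> by
  \<open>q\<^sup>2 * X\<close> and \<open>y\<close> by \<open>y + 1\<close> multiplies the
  coefficient \<open>X\<^sup>2 / q ^ (2 * y + 3)\<close> by \<open>q\<^sup>2\<close>, and this is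
  also the factor by which the coefficients here grow from \<open>x\<close> to
  \<open>x + 1\<close>.\<close>

lemma alt_sum_Suc:
  "alt_sum q (Suc y) (q\<^sup>2 * X) (Suc x) = q ^ (2 * x + 2) * alt_sum q y X (Suc x) - q ^ (2 * x) * alt_sum q y X x"
proof (induction y arbitrary: X x)
  case 0
  have "q\<^sup>2 * X / q\<^sup>2 = X" and "(q\<^sup>2 * X)\<^sup>2 / q ^ (2 * 0 + 3) = q * X\<^sup>2"
    using q0 by (simp_all add: field_simps eval_nat_numeral)
  then show ?case
    unfolding alt_sum.simps alt_count_mult2 by (simp add: algebra_simps)
next
  case (Suc y)
  \<comment> \<open>The induction hypothesis is used at two places: at \<open>X\<close>, and at
    \<open>Z\<close> through \<open>X = q\<^sup>2 * Z\<close>.\<close>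
  define Z where "Z = X / q\<^sup>2"
  have XZ: "X = q\<^sup>2 * Z" using q0 by (simp add: Z_def)
  have 1: "alt_sum q (Suc (Suc y)) (q\<^sup>2 * X) (Suc x) =
      alt_sum q (Suc y) (q\<^sup>2 * X) (Suc x) - (q\<^sup>2 * X)\<^sup>2 / q ^ (2 * y + 5) * alt_sum q (Suc y) X x"
    using q0 by (simp add: eval_nat_numeral)
  have 2: "q ^ (2 * y + 5) = q ^ (2 * y + 3) * q\<^sup>2" by (simp add: eval_nat_numeral)
  show ?case
  proof (cases x)
    case 0
    then show ?thesis unfolding 1 2 Suc.IH using q0
      by (simp add: field_simps eval_nat_numeral)
  next
    case (Suc x')
    have 3: "alt_sum q (Suc y) X x = q ^ (2 * x' + 2) * alt_sum q y Z (Suc x') - q ^ (2 * x') * alt_sum q y Z x'"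
      unfolding XZ Suc Suc.IH ..
    have 4: "alt_sum q (Suc y) X (Suc x) = alt_sum q y X (Suc x) - X\<^sup>2 / q ^ (2 * y + 3) * alt_sum q y Z x"
      by (simp add: Z_def)
    have 5: "alt_sum q (Suc y) X x = alt_sum q y X x - X\<^sup>2 / q ^ (2 * y + 3) * alt_sum q y Z x'"
      by (simp add: Z_def Suc)
    define K where "K = X\<^sup>2 / q ^ (2 * y + 3)"
    have K: "(q\<^sup>2 * X)\<^sup>2 / (q ^ (2 * y + 3) * q\<^sup>2) = K * q\<^sup>2"
      using q0 by (simp add: K_def field_simps power2_eq_square)
    have "q ^ (2 * x + 2) * alt_sum q y X (Suc x) - q ^ (2 * x) * alt_sum q y X x - K * q\<^sup>2 * alt_sum q (Suc y) X x
       = q ^ (2 * x + 2) * alt_sum q (Suc y) X (Suc x) - q ^ (2 * x) * (alt_sum q y X x - K * alt_sum q y Z x')"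
      unfolding 3 4 K_def[symmetric] by (simp add: Suc algebra_simps power2_eq_square)
    then show ?thesis unfolding 1 2 Suc.IH K 5 K_def[symmetric] .
  qed
qed

section \<open>Agreement of the Krawtchouk sum with \<open>alt_sum\<close>\<close>

lemma square_power_neq_1: "(q\<^sup>2) ^ Suc k \<noteq> 1"
  using q1[of "2 * Suc k"] by (simp only: power_mult) simp

text \<open>The numerator begins with the factor \<open>1 - 1\<close>.\<close>

lemma krawtchouk_term_0_Suc: "krawtchouk_term q N Y 0 (Suc k) = 0"
  by (simp add: krawtchouk_term_def q_pochhammer_Suc_left[OF refl])

lemma krawtchouk_prefactor_Suc:
  "(-1) ^ Suc x * q ^ (Suc x * (Suc x - 1)) * q_pochhammer (q\<^sup>2 * Y) (inverse (q\<^sup>2)) (Suc x) * gaussian_poly (Suc N) (Suc x) (q\<^sup>2)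
   = - ((q\<^sup>2) ^ x * (1 - q\<^sup>2 * Y) * (1 - (q\<^sup>2) ^ Suc N) / (1 - (q\<^sup>2) ^ Suc x)) *
     ((-1) ^ x * q ^ (x * (x - 1)) * q_pochhammer Y (inverse (q\<^sup>2)) x * gaussian_poly N x (q\<^sup>2))"
proof -
  have e: "Suc x * (Suc x - 1) = x * (x - 1) + 2 * x" by (cases x) auto
  have p: "q_pochhammer (q\<^sup>2 * Y) (inverse (q\<^sup>2)) (Suc x) = (1 - q\<^sup>2 * Y) * q_pochhammer Y (inverse (q\<^sup>2)) x"
    by (rule q_pochhammer_Suc_left) (use q0 in simp)
  have g: "gaussian_poly (Suc N) (Suc x) (q\<^sup>2) = (1 - (q\<^sup>2) ^ Suc N) / (1 - (q\<^sup>2) ^ Suc x) * gaussian_poly N x (q\<^sup>2)"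
    by (rule gaussian_poly_Suc_Suc) (use q0 in simp)
  show ?thesis unfolding e p g power_add power_mult by simp
qed

text \<open>Every product loses one factor. The lost factors pair up as
  \<open>(1 - z) / (1 - inverse z) = - z\<close> for the parameters \<open>Y\<close> and
  \<open>N\<close>, and as the reciprocal for \<open>x\<close>. The factor
  \<open>1 - (q\<^sup>2) ^ Suc k\<close> on the left clears the one lost from
  \<open>q_pochhammer (q\<^sup>2) (q\<^sup>2)\<close>; it will be supplied by the difference in
  \<open>y\<close>.\<close>

lemma krawtchouk_term_Suc_Suc:
  assumes Y: "Y \<noteq> 0" "q\<^sup>2 * Y \<noteq> 1"
  shows "(1 - (q\<^sup>2) ^ Suc k) * krawtchouk_term q (Suc N) (q\<^sup>2 * Y) (Suc x) (Suc k) =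
     (q\<^sup>2 * Y) * (q\<^sup>2) ^ Suc N * krawtchouk_term q N Y x k"
proof -
  have P: "q_pochhammer (inverse (q\<^sup>2) ^ Suc j) (q\<^sup>2) (Suc k) =
      (1 - inverse ((q\<^sup>2) ^ Suc j)) * q_pochhammer (inverse (q\<^sup>2) ^ j) (q\<^sup>2) k" for j
    unfolding power_inverse[symmetric, of "q\<^sup>2" "Suc j"]
    by (rule q_pochhammer_Suc_left) (use q0 in simp)
  have PY: "q_pochhammer (inverse (q\<^sup>2 * Y)) (q\<^sup>2) (Suc k) =
      (1 - inverse (q\<^sup>2 * Y)) * q_pochhammer (inverse Y) (q\<^sup>2) k"
    by (rule q_pochhammer_Suc_left) (use q0 in simp)
  have Pq: "q_pochhammer (q\<^sup>2) (q\<^sup>2) (Suc k) = (1 - (q\<^sup>2) ^ Suc k) * q_pochhammer (q\<^sup>2) (q\<^sup>2) k"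
    by (simp add: q_pochhammer_Suc)
  have r: "(1 - z) / (1 - inverse z) = - z" if "z \<noteq> 0" "z \<noteq> 1" for z :: 'b
    using that by (simp add: field_simps)
  have r': "(1 - inverse z) / (1 - z) = - inverse z" if "z \<noteq> 0" "z \<noteq> 1" for z :: 'b
    using that by (simp add: field_simps)
  define C where "C = (-1) ^ x * q ^ (x * (x - 1)) * q_pochhammer Y (inverse (q\<^sup>2)) x * gaussian_poly N x (q\<^sup>2)"
  define a b c d where "a = q_pochhammer (inverse (q\<^sup>2) ^ x) (q\<^sup>2) k" "b = q_pochhammer (inverse (q\<^sup>2) ^ N) (q\<^sup>2) k"
    "c = q_pochhammer (inverse Y) (q\<^sup>2) k" "d = q_pochhammer (q\<^sup>2) (q\<^sup>2) k"
  define t u v w where "t = (q\<^sup>2) ^ Suc k" "u = (q\<^sup>2) ^ Suc x" "v = q\<^sup>2 * Y" "w = (q\<^sup>2) ^ Suc N"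
  have nz: "t \<noteq> 1" "u \<noteq> 0" "u \<noteq> 1" "v \<noteq> 0" "v \<noteq> 1" "w \<noteq> 0" "w \<noteq> 1"
    unfolding t_u_v_w_def using square_power_neq_1 q0 Y by simp_all
  have "(1 - t) * krawtchouk_term q (Suc N) v (Suc x) (Suc k) =
     (1 - t) * (- ((q\<^sup>2) ^ x * (1 - v) * (1 - w) / (1 - u)) * C *
      (((1 - inverse u) * a) / (((1 - inverse w) * b) * ((1 - inverse v) * c) * ((1 - t) * d)) * t))"
    unfolding krawtchouk_term_def krawtchouk_prefactor_Suc P t_u_v_w_def PY Pq C_def a_b_c_d_def ..
  also have "\<dots> = ((1 - t) / (1 - t)) * (- ((q\<^sup>2) ^ x)) * ((1 - v) / (1 - inverse v)) * ((1 - w) / (1 - inverse w)) *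
       ((1 - inverse u) / (1 - u)) * C * (a / (b * c * d) * t)"
    by (simp add: divide_inverse mult_ac)
  also have "\<dots> = (q\<^sup>2) ^ x * v * w * inverse u * C * (a / (b * c * d) * t)"
    using nz by (simp add: r r')
  also have "\<dots> = v * w * (C * (a / (b * c * d) * (q\<^sup>2) ^ k))"
  proof -
    have "(q\<^sup>2) ^ x * inverse u * t = (q\<^sup>2) ^ k"
      using q0 by (simp add: t_u_v_w_def field_simps)
    moreover have "(q\<^sup>2) ^ x * v * w * inverse u * C * (a / (b * c * d) * t) =
        v * w * (C * (a / (b * c * d) * ((q\<^sup>2) ^ x * inverse u * t)))"
      by (simp only: mult_ac)
    ultimately show ?thesis by simp
  qed
  also have "\<dots> = v * w * krawtchouk_term q N Y x k"
    by (simp add: krawtchouk_term_def C_def a_b_c_d_def)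
  finally show ?thesis by (simp only: t_u_v_w_def)
qed

text \<open>The two alternatives for \<open>X = q ^ n\<close> and \<open>Y\<close> are \<open>n = 2 * N\<close> and \<open>n = 2 * N + 1\<close>.\<close>

lemma krawtchouk_term_0:
  assumes "X = (q\<^sup>2) ^ N \<and> Y = X / q \<or> X = q * (q\<^sup>2) ^ N \<and> Y = X" and "x \<le> N"
  shows "krawtchouk_term q N Y x 0 = alt_count q X x"
  using assms
proof (induction x arbitrary: N X Y)
  case 0
  then show ?case by (simp add: krawtchouk_term_def gaussian_poly_def)
next
  case (Suc x)
  then obtain M where N: "N = Suc M" by (cases N) auto
  define Y' where "Y' = Y / q\<^sup>2"
  define X' where "X' = X / q\<^sup>2"
  have Y: "Y = q\<^sup>2 * Y'" and X: "X = q\<^sup>2 * X'" using q0 by (simp_all add: Y'_def X'_def)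
  have "X' = (q\<^sup>2) ^ M \<and> Y' = X' / q \<or> X' = q * (q\<^sup>2) ^ M \<and> Y' = X'"
    using Suc.prems(1) q0 unfolding X'_def Y'_def N by auto
  then have IH: "krawtchouk_term q M Y' x 0 = alt_count q X' x"
    using Suc N by auto
  \<comment> \<open>In both parities \<open>Y\<close> and \<open>(q\<^sup>2) ^ N\<close> are
    \<open>X\<close> and \<open>X / q\<close> in some order, so one computation serves both.\<close>
  have e: "(1 - Y) * (1 - (q\<^sup>2) ^ N) = (X - 1) * (X - q) / q"
    using Suc.prems(1) q0 by (auto simp: field_simps)
  have s: "1 - (q\<^sup>2) ^ Suc x = - (q ^ (2 * x + 2) - 1)" "q ^ (2 * x + 2) - 1 \<noteq> 0"
    using q1[of "2 * x + 2"] by (simp_all only: power_mult[symmetric]) simp_all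
  have "krawtchouk_term q N Y (Suc x) 0 =
     - ((q\<^sup>2) ^ x * ((1 - Y) * (1 - (q\<^sup>2) ^ N)) / (1 - (q\<^sup>2) ^ Suc x)) * krawtchouk_term q M Y' x 0"
    unfolding krawtchouk_term_def N Y krawtchouk_prefactor_Suc by simp
  also have "\<dots> = alt_count q X (Suc x)"
  proof -
    have c: "- (u * (A / q) / - d) * V = u * A * V / (q * d)" if "d \<noteq> 0" for u A V d :: 'b
      using that q0 by (simp add: field_simps)
    show ?thesis
      unfolding e s(1) IH alt_count_Suc_left X'_def[symmetric]
      unfolding power_mult[symmetric] c[OF s(2)]
      by (simp only: mult_ac)
  qed
  finally show ?case .
qed

text \<open>Only the first Pochhammer factor of a summand depends on \<open>y\<close>. Its
  difference between \<open>y + 1\<close> and \<open>y\<close> turns, by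
  \<open>krawtchouk_term_Suc_Suc\<close>, into the corresponding sum for \<open>N - 1\<close> and
  \<open>x - 1\<close>, which is the defining recursion of \<open>alt_sum\<close>.\<close>

lemma alt_sum_eq_krawtchouk_sum:
  assumes "X = (q\<^sup>2) ^ N \<and> Y = X / q \<or> X = q * (q\<^sup>2) ^ N \<and> Y = X" and "x \<le> N" and "y \<le> N"
  shows "alt_sum q y X x = (\<Sum>k\<le>y. q_pochhammer (inverse (q\<^sup>2) ^ y) (q\<^sup>2) k * krawtchouk_term q N Y x k)"
  using assms
proof (induction y arbitrary: N X Y x)
  case 0
  then show ?case by (simp add: krawtchouk_term_0)
next
  case (Suc y)
  then obtain M where N: "N = Suc M" by (cases N) auto
  let ?r = "inverse (q\<^sup>2)" and ?W = "krawtchouk_term q N Y x"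
  \<comment> \<open>Both products contain \<open>q_pochhammer (?r ^ y) (q\<^sup>2) j\<close>; the
    first has an additional factor in front, the second one at the end.\<close>
  have d: "q_pochhammer (?r ^ Suc y) (q\<^sup>2) (Suc j) - q_pochhammer (?r ^ y) (q\<^sup>2) (Suc j) =
      - (?r ^ Suc y * (1 - (q\<^sup>2) ^ Suc j) * q_pochhammer (?r ^ y) (q\<^sup>2) j)" for j
  proof -
    have "q_pochhammer (?r ^ Suc y) (q\<^sup>2) (Suc j) = (1 - ?r ^ Suc y) * q_pochhammer (?r ^ y) (q\<^sup>2) j"
      by (rule q_pochhammer_Suc_left) (use q0 in simp)
    moreover have "q_pochhammer (?r ^ y) (q\<^sup>2) (Suc j) = (1 - ?r ^ Suc y * (q\<^sup>2) ^ Suc j) * q_pochhammer (?r ^ y) (q\<^sup>2) j"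
      using q0 by (simp add: q_pochhammer_Suc)
    ultimately show ?thesis by (simp only:) (simp add: algebra_simps)
  qed
  \<comment> \<open>The factor with index \<open>y\<close> vanishes, so the sum for \<open>y\<close>
    may be extended to \<open>Suc y\<close> and subtracted termwise.\<close>
  have z: "q_pochhammer (?r ^ y) (q\<^sup>2) (Suc y) = 0"
    using q0 by (simp add: q_pochhammer_Suc power_inverse)
  have IH: "alt_sum q y X x = (\<Sum>k\<le>Suc y. q_pochhammer (?r ^ y) (q\<^sup>2) k * ?W k)"
    using Suc.IH[OF Suc.prems(1,2)] Suc.prems(3) by (simp add: z)
  have diff: "(\<Sum>k\<le>Suc y. q_pochhammer (?r ^ Suc y) (q\<^sup>2) k * ?W k) - alt_sum q y X x =
      - (?r ^ Suc y * (\<Sum>j\<le>y. q_pochhammer (?r ^ y) (q\<^sup>2) j * ((1 - (q\<^sup>2) ^ Suc j) * ?W (Suc j))))"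
    unfolding IH sum_subtractf[symmetric] left_diff_distrib[symmetric]
    by (subst sum.atMost_Suc_shift) (simp only: d, simp add: sum_distrib_left sum_negf mult_ac)
  show ?case
  proof (cases x)
    case 0
    then show ?thesis using diff by (simp add: krawtchouk_term_0_Suc alt_sum_0_right)
  next
    case (Suc x')
    define Y' where "Y' = Y / q\<^sup>2"
    define X' where "X' = X / q\<^sup>2"
    have Y: "Y = q\<^sup>2 * Y'" and X: "X = q\<^sup>2 * X'" using q0 by (simp_all add: Y'_def X'_def)
    have h: "X' = (q\<^sup>2) ^ M \<and> Y' = X' / q \<or> X' = q * (q\<^sup>2) ^ M \<and> Y' = X'"
      using Suc.prems(1) q0 unfolding X'_def Y'_def N by auto
    have IH': "alt_sum q y X' x' = (\<Sum>k\<le>y. q_pochhammer (?r ^ y) (q\<^sup>2) k * krawtchouk_term q M Y' x' k)"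
      using Suc.IH[OF h] Suc.prems N Suc by simp
    have Y'0: "Y' \<noteq> 0" using h q0 by auto
    have "Y = q ^ (2 * M + 1) \<or> Y = q ^ (2 * M + 3)"
    proof -
      have "(q\<^sup>2) ^ M = q ^ (2 * M)" by (simp add: power_mult)
      then show ?thesis using h q0 unfolding Y by (auto simp: power2_eq_square eval_nat_numeral)
    qed
    then have Y1: "q\<^sup>2 * Y' \<noteq> 1" using q1[of "2 * M + 1"] q1[of "2 * M + 3"] Y by auto
    have e: "q\<^sup>2 * Y' * (q\<^sup>2) ^ Suc M = X\<^sup>2 / q"
      using Suc.prems(1) q0 unfolding Y[symmetric] N[symmetric] by (auto simp: power2_eq_square)
    have W: "(1 - (q\<^sup>2) ^ Suc j) * ?W (Suc j) = X\<^sup>2 / q * krawtchouk_term q M Y' x' j" for j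
      unfolding Suc N Y krawtchouk_term_Suc_Suc[OF Y'0 Y1] e ..
    have "(\<Sum>k\<le>Suc y. q_pochhammer (?r ^ Suc y) (q\<^sup>2) k * ?W k) - alt_sum q y X x =
       - (?r ^ Suc y * (X\<^sup>2 / q * alt_sum q y X' x'))"
      unfolding diff W IH' by (simp add: sum_distrib_left mult_ac)
    also have "\<dots> = - (X\<^sup>2 / q ^ (2 * y + 3) * alt_sum q y X' x')"
      using q0 by (simp add: power_inverse power_mult[symmetric] power_add field_simps eval_nat_numeral)
    finally show ?thesis unfolding Suc by (simp add: X'_def algebra_simps)
  qed
qed

end

subsection \<open>Ranges, ranks and characters over a finite field\<close>

lemma carrier_vec_Suc: "carrier_vec (Suc n) = (\<lambda>(t, w). vCons t w) ` (UNIV \<times> carrier_vec n)"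
proof (intro equalityI subsetI)
  fix v assume "v \<in> carrier_vec (Suc n)"
  then show "v \<in> (\<lambda>(t, w). vCons t w) ` (UNIV \<times> carrier_vec n)"
    by (cases v) auto
qed auto

lemma carrier_vec_0: "carrier_vec 0 = {vNil}"
  by auto

lemma finite_carrier_vec: "finite (carrier_vec n :: 'a::finite vec set)"
  by (induction n) (simp_all add: carrier_vec_0 carrier_vec_Suc)

lemma card_carrier_vec: "card (carrier_vec n :: 'a::finite vec set) = CARD('a) ^ n"
proof (induction n)
  case 0
  show ?case by (simp add: carrier_vec_0)
next
  case (Suc n)
  have "card (carrier_vec (Suc n) :: 'a vec set) = card (UNIV \<times> carrier_vec n :: ('a \<times> 'a vec) set)"
    unfolding carrier_vec_Suc by (rule card_image) (auto simp: inj_on_def)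
  then show ?case using Suc by (simp add: card_cartesian_product)
qed

definition mat_range :: "'a::semiring_0 mat \<Rightarrow> 'a vec set" where
  "mat_range A = (\<lambda>v. A *\<^sub>v v) ` carrier_vec (dim_col A)"

lemma mat_range_eq: "A \<in> carrier_mat n m \<Longrightarrow> mat_range A = (\<lambda>v. A *\<^sub>v v) ` carrier_vec m"
  by (auto simp: mat_range_def)

lemma mat_range_carrier: "A \<in> carrier_mat n m \<Longrightarrow> mat_range A \<subseteq> carrier_vec n"
  by (auto simp: mat_range_def)

text \<open>A maximal independent set of columns has \<open>rank\<close> elements and spans the same
  range, and the matrix formed by it is injective on coordinate vectors. Ranks are compared below by
  counting ranges.\<close>

lemma card_mat_range:
  fixes A :: "'a::{finite, field} mat"
  assumes A: "A \<in> carrier_mat n m"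
  shows "card (mat_range A) = CARD('a) ^ vec_space.rank n A"
proof -
  interpret vec_space "TYPE('a)" n .
  have cols: "set (cols A) \<subseteq> carrier_vec n" using cols_dim A by blast
  obtain U where U: "maximal U (\<lambda>T. T \<subseteq> set (cols A) \<and> lin_indpt T)" "finite U"
    using maximal_exists_superset[of "set (cols A)" "\<lambda>T. T \<subseteq> set (cols A) \<and> lin_indpt T" "{}"]
    by (meson List.finite_set empty_iff empty_subsetI finite.emptyI finite_lin_indpt2)
  have Uc: "U \<subseteq> set (cols A)" and Ui: "lin_indpt U" using U(1) by (auto simp: maximal_def)
  have sp: "span U = span (set (cols A))"
  proof
    show "span U \<subseteq> span (set (cols A))" using Uc by (rule span_is_monotone)
    have "set (cols A) \<subseteq> span U"
    proof
      fix s assume s: "s \<in> set (cols A)"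
      show "s \<in> span U"
      proof (rule ccontr)
        assume ns: "s \<notin> span U"
        have "lin_indpt (insert s U)"
          using lin_dep_iff_in_span[of U s] Ui ns s Uc cols by (metis Un_insert_right span_mem subset_iff sup_bot.right_neutral)
        moreover have "s \<notin> U" using ns Uc cols span_mem by (metis subset_trans)
        ultimately show False using U(1) s Uc unfolding maximal_def by blast
      qed
    qed
    then show "span (set (cols A)) \<subseteq> span U"
      using Uc cols by (meson span_is_submodule span_is_subset subset_trans)
  qed
  obtain us where us: "set us = U" "distinct us" using U(2) finite_distinct_list by blast
  define M where "M = mat_of_cols n us"
  have Mc: "cols M = us" and M: "M \<in> carrier_mat n (length us)"
    using us Uc cols by (auto simp: M_def intro!: cols_mat_of_cols)
  have r: "rank A = length us" using rank_card_indpt[OF A U(1)] us distinct_card by force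
  have "mat_range B = span (set (cols B))" if "B \<in> carrier_mat n k" for B k
    using col_space_eq[OF that] that unfolding col_space_def mat_range_def by auto
  then have eq: "mat_range A = mat_range M" using A M sp Mc us by metis
  have "inj_on (\<lambda>v. M *\<^sub>v v) (carrier_vec (length us))"
  proof
    fix v w assume v: "v \<in> carrier_vec (length us)" and w: "w \<in> carrier_vec (length us)"
      and e: "M *\<^sub>v v = M *\<^sub>v w"
    have "M *\<^sub>v (v - w) = 0\<^sub>v n" using e M v w by (simp add: mult_minus_distrib_mat_vec)
    then have "v - w = 0\<^sub>v (length us)"
      using lin_depI[OF M _ _ _ , of "v - w"] v w Ui us Mc by (metis minus_carrier_vec)
    show "v = w"
    proof (rule eq_vecI)
      fix i assume "i < dim_vec w"
      then show "v $ i = w $ i"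
        using arg_cong[OF \<open>v - w = 0\<^sub>v (length us)\<close>, of "\<lambda>u. u $ i"] v w by simp
    qed (use v w in auto)
  qed
  then show ?thesis unfolding eq r mat_range_eq[OF M] by (simp add: card_image card_carrier_vec)
qed

section \<open>Subspaces, orthogonal complements and orthogonality of characters\<close>

definition vec_subspace :: "nat \<Rightarrow> 'a::semiring_0 vec set \<Rightarrow> bool" where
  "vec_subspace n H \<longleftrightarrow> H \<subseteq> carrier_vec n \<and> 0\<^sub>v n \<in> H \<and>
     (\<forall>u\<in>H. \<forall>v\<in>H. u + v \<in> H) \<and> (\<forall>c. \<forall>v\<in>H. c \<cdot>\<^sub>v v \<in> H)"

definition orthogonal_complement :: "nat \<Rightarrow> 'a::semiring_0 vec set \<Rightarrow> 'a vec set" where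
  "orthogonal_complement n H = {v \<in> carrier_vec n. \<forall>h\<in>H. v \<bullet> h = 0}"

lemma vec_subspace_carrier: "vec_subspace n (carrier_vec n)"
  by (simp add: vec_subspace_def)

lemma vec_subspace_orthogonal_complement:
  fixes H :: "'a::comm_ring_1 vec set"
  assumes "H \<subseteq> carrier_vec n"
  shows "vec_subspace n (orthogonal_complement n H)"
  using assms unfolding vec_subspace_def orthogonal_complement_def
  by (auto simp: add_scalar_prod_distrib[of _ n] subset_iff)

lemma vec_subspace_mat_range:
  fixes A :: "'a::field mat"
  assumes A: "A \<in> carrier_mat n m"
  shows "vec_subspace n (mat_range A)"
proof -
  have "0\<^sub>v n = A *\<^sub>v 0\<^sub>v m" by (rule eq_vecI) (use A in auto)
  moreover have "A *\<^sub>v u + A *\<^sub>v v = A *\<^sub>v (u + v)" if "u \<in> carrier_vec m" "v \<in> carrier_vec m" for u v :: "'a vec"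
    using mult_add_distrib_mat_vec[OF A that] by simp
  moreover have "c \<cdot>\<^sub>v (A *\<^sub>v v) = A *\<^sub>v (c \<cdot>\<^sub>v v)" if "v \<in> carrier_vec m" for v :: "'a vec" and c
    using mult_mat_vec[OF A that] by simp
  ultimately show ?thesis
    using A unfolding vec_subspace_def mat_range_eq[OF A] by auto
qed

lemma scalar_prod_eq_0_carrier:
  assumes a: "(a :: 'a::comm_ring_1 vec) \<in> carrier_vec n" and "\<forall>v\<in>carrier_vec n. a \<bullet> v = 0"
  shows "a = 0\<^sub>v n"
proof (rule eq_vecI)
  fix i assume "i < dim_vec (0\<^sub>v n :: 'a vec)"
  then have i: "i < n" by simp
  have "a \<bullet> unit_vec n i = 0" using assms(2) by simp
  then show "a $ i = 0\<^sub>v n $ i" using scalar_prod_right_unit[OF i, of a] i by simp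
qed (use a in auto)

text \<open>The locale is applied at the end to the complex conjugate of the given
  character.\<close>

locale additive_character =
  fixes \<chi> :: "'a::{finite, field} \<Rightarrow> complex"
  assumes nontrivial: "nontrivial_additive_character \<chi>"
begin

lemma char_add: "\<chi> (u + v) = \<chi> u * \<chi> v"
  using nontrivial by (simp add: nontrivial_additive_character_def)

lemma char_0 [simp]: "\<chi> 0 = 1"
  using char_add[of 0 0] nontrivial by (simp add: nontrivial_additive_character_def)

text \<open>If \<open>a\<close> is not orthogonal to \<open>H\<close>, scaling gives
  \<open>g\<close> in \<open>H\<close> with \<open>\<chi> (a \<bullet> g) \<noteq> 1\<close>.
  Translating \<open>H\<close> by \<open>g\<close> multiplies the sum by this value, so the sum is
  zero.\<close>

lemma sum_char_subspace:
  assumes H: "vec_subspace n (H :: 'a vec set)" and a: "a \<in> carrier_vec n"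
  shows "(\<Sum>v\<in>H. \<chi> (a \<bullet> v)) = (if \<forall>v\<in>H. a \<bullet> v = 0 then of_nat (card H) else 0)"
proof (cases "\<forall>v\<in>H. a \<bullet> v = 0")
  case False
  then obtain h where h: "h \<in> H" "a \<bullet> h \<noteq> 0" by blast
  obtain u where u: "\<chi> u \<noteq> 1" using nontrivial by (auto simp: nontrivial_additive_character_def)
  define g where "g = (u / (a \<bullet> h)) \<cdot>\<^sub>v h"
  have Hc: "\<And>v. v \<in> H \<Longrightarrow> v \<in> carrier_vec n" using H by (auto simp: vec_subspace_def)
  have g: "g \<in> H" "- 1 \<cdot>\<^sub>v g \<in> H" using H h by (auto simp: g_def vec_subspace_def)
  have ag: "a \<bullet> g = u" using h a Hc by (simp add: g_def)
  have "(\<Sum>v\<in>H. \<chi> (a \<bullet> v)) = (\<Sum>v\<in>H. \<chi> (a \<bullet> (g + v)))"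
  proof (rule sum.reindex_bij_witness[of _ "\<lambda>v. g + v" "\<lambda>v. - 1 \<cdot>\<^sub>v g + v"])
    fix v assume v: "v \<in> H"
    show "g + (- 1 \<cdot>\<^sub>v g + v) = v" "- 1 \<cdot>\<^sub>v g + (g + v) = v"
      using Hc[OF v] Hc[OF g(1)] by (auto intro!: eq_vecI)
    then show "\<chi> (a \<bullet> (g + (- 1 \<cdot>\<^sub>v g + v))) = \<chi> (a \<bullet> v)" by simp
  qed (use g H in \<open>auto simp: vec_subspace_def\<close>)
  also have "\<dots> = \<chi> u * (\<Sum>v\<in>H. \<chi> (a \<bullet> v))"
    unfolding sum_distrib_left
    by (rule sum.cong) (use a Hc Hc[OF g(1)] ag in \<open>simp_all add: scalar_prod_add_distrib[of _ n] char_add\<close>)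
  finally have "(1 - \<chi> u) * (\<Sum>v\<in>H. \<chi> (a \<bullet> v)) = 0" by (simp add: algebra_simps)
  then show ?thesis using u False by auto
qed simp

text \<open>The sum of \<open>\<chi> (v \<bullet> h)\<close> over all \<open>v\<close> and all
  \<open>h\<close> in \<open>H\<close> is evaluated in both orders: summing over \<open>h\<close>
  first leaves the \<open>v\<close> in the complement, summing over \<open>v\<close> first leaves
  only \<open>h = 0\<close>.\<close>

lemma card_orthogonal_complement:
  assumes H: "vec_subspace n (H :: 'a vec set)"
  shows "card H * card (orthogonal_complement n H) = CARD('a) ^ n"
proof -
  let ?V = "carrier_vec n :: 'a vec set"
  have Hc: "H \<subseteq> ?V" and H0: "0\<^sub>v n \<in> H" using H by (auto simp: vec_subspace_def)
  have fin: "finite H" using Hc finite_carrier_vec finite_subset by blast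
  have "(\<Sum>v\<in>?V. \<Sum>h\<in>H. \<chi> (v \<bullet> h)) = (\<Sum>v\<in>?V. if \<forall>h\<in>H. v \<bullet> h = 0 then of_nat (card H) else 0)"
    by (rule sum.cong) (auto simp: sum_char_subspace[OF H])
  also have "\<dots> = of_nat (card H * card (orthogonal_complement n H))"
    by (simp add: sum.If_cases finite_carrier_vec orthogonal_complement_def Int_def mult.commute)
  finally have 1: "(\<Sum>v\<in>?V. \<Sum>h\<in>H. \<chi> (v \<bullet> h)) = of_nat (card H * card (orthogonal_complement n H))" .
  have "(\<Sum>v\<in>?V. \<Sum>h\<in>H. \<chi> (v \<bullet> h)) = (\<Sum>h\<in>H. \<Sum>v\<in>?V. \<chi> (v \<bullet> h))"
    by (rule sum.swap)
  also have "\<dots> = (\<Sum>h\<in>H. \<Sum>v\<in>?V. \<chi> (h \<bullet> v))"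
    by (intro sum.cong refl arg_cong[of _ _ \<chi>] comm_scalar_prod) (use Hc in auto)
  also have "\<dots> = (\<Sum>h\<in>H. if h = 0\<^sub>v n then of_nat (card ?V) else 0)"
  proof (rule sum.cong[OF refl])
    fix h assume "h \<in> H"
    then have h: "h \<in> ?V" using Hc by auto
    have "(\<forall>v\<in>?V. h \<bullet> v = 0) \<longleftrightarrow> h = 0\<^sub>v n" using scalar_prod_eq_0_carrier[OF h] by auto
    then show "(\<Sum>v\<in>?V. \<chi> (h \<bullet> v)) = (if h = 0\<^sub>v n then of_nat (card ?V) else 0)"
      using sum_char_subspace[OF vec_subspace_carrier h] by simp
  qed
  also have "\<dots> = of_nat (CARD('a) ^ n)" using fin H0 by (simp add: card_carrier_vec)
  finally show ?thesis using 1 of_nat_eq_iff by metis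
qed

text \<open>One inclusion is clear, and applying the cardinality formula twice shows that both sets
  have the same size.\<close>

lemma orthogonal_complement_twice:
  assumes H: "vec_subspace n (H :: 'a vec set)"
  shows "orthogonal_complement n (orthogonal_complement n H) = H"
proof -
  let ?P = "orthogonal_complement n H"
  have Hc: "H \<subseteq> carrier_vec n" using H by (auto simp: vec_subspace_def)
  have P: "vec_subspace n ?P" using vec_subspace_orthogonal_complement[OF Hc] .
  have "card ?P * card (orthogonal_complement n ?P) = card ?P * card H"
    using card_orthogonal_complement[OF H] card_orthogonal_complement[OF P] by (simp add: mult.commute)
  moreover have "card ?P \<noteq> 0" using card_orthogonal_complement[OF H] by (metis mult_0_right power_not_zero zero_less_card_finite less_numeral_extra(3))
  ultimately have c: "card (orthogonal_complement n ?P) = card H" by simp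
  have sub: "H \<subseteq> orthogonal_complement n ?P"
  proof
    fix h assume h: "h \<in> H"
    have "h \<bullet> v = 0" if "v \<in> ?P" for v
      using that h Hc comm_scalar_prod[of h n v] by (auto simp: orthogonal_complement_def)
    then show "h \<in> orthogonal_complement n ?P" using h Hc by (auto simp: orthogonal_complement_def)
  qed
  have "finite (orthogonal_complement n ?P)"
    by (rule finite_subset[OF _ finite_carrier_vec[of n]]) (auto simp: orthogonal_complement_def)
  then show ?thesis using card_subset_eq[OF _ sub] c by simp
qed

end

subsection \<open>Bordered alternating matrices\<close>

text \<open>The new index comes first, so that the matrix acts on vectors \<open>vCons t w\<close>
  with \<open>t\<close> the new coordinate.\<close>

definition bordered_mat :: "'a::{zero, uminus} vec \<Rightarrow> 'a mat \<Rightarrow> 'a mat" where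
  "bordered_mat a A = mat (Suc (dim_vec a)) (Suc (dim_vec a))
     (\<lambda>(i, j). case i of 0 \<Rightarrow> (case j of 0 \<Rightarrow> 0 | Suc j \<Rightarrow> - a $ j)
        | Suc i \<Rightarrow> (case j of 0 \<Rightarrow> a $ i | Suc j \<Rightarrow> A $$ (i, j)))"

lemma bordered_mat_carrier [simp]:
  "a \<in> carrier_vec n \<Longrightarrow> bordered_mat a A \<in> carrier_mat (Suc n) (Suc n)"
  by (simp add: bordered_mat_def)

lemma bordered_mat_mult_vec:
  fixes a :: "'a::comm_ring_1 vec"
  assumes a: "a \<in> carrier_vec n" and A: "A \<in> carrier_mat n n" and w: "w \<in> carrier_vec n"
  shows "bordered_mat a A *\<^sub>v vCons t w = vCons (- (a \<bullet> w)) (t \<cdot>\<^sub>v a + A *\<^sub>v w)"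
proof (rule eq_vecI)
  fix i assume i: "i < dim_vec (vCons (- (a \<bullet> w)) (t \<cdot>\<^sub>v a + A *\<^sub>v w))"
  have s: "(bordered_mat a A *\<^sub>v vCons t w) $ i = (\<Sum>j<Suc n. bordered_mat a A $$ (i, j) * vCons t w $ j)"
    using i a A w by (auto simp: scalar_prod_def bordered_mat_def lessThan_atLeast0 intro!: sum.cong)
  show "(bordered_mat a A *\<^sub>v vCons t w) $ i = vCons (- (a \<bullet> w)) (t \<cdot>\<^sub>v a + A *\<^sub>v w) $ i"
  proof (cases i)
    case 0
    then show ?thesis unfolding s sum.lessThan_Suc_shift using i a A w
      by (simp add: bordered_mat_def scalar_prod_def lessThan_atLeast0 sum_negf del: sum.lessThan_Suc)
  next
    case (Suc k)
    then show ?thesis unfolding s sum.lessThan_Suc_shift using i a A w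
      by (simp add: bordered_mat_def scalar_prod_def lessThan_atLeast0 mult.commute del: sum.lessThan_Suc)
  qed
qed (use a A in \<open>simp add: bordered_mat_def\<close>)

lemma alternating_mats_carrier: "A \<in> alternating_mats n \<Longrightarrow> A \<in> carrier_mat n n"
  by (simp add: alternating_mats_def)

lemma alternating_mats_iff:
  "A \<in> alternating_mats n \<longleftrightarrow> A \<in> carrier_mat n n \<and>
     (\<forall>i<n. \<forall>j<n. A $$ (j, i) + A $$ (i, j) = 0) \<and> (\<forall>i<n. A $$ (i, i) = 0)"
proof (cases "A \<in> carrier_mat n n")
  case True
  have "transpose_mat A = - A \<longleftrightarrow> (\<forall>i<n. \<forall>j<n. A $$ (j, i) = - A $$ (i, j))"
    using True by (simp add: mat_eq_iff)
  then show ?thesis using True by (simp add: alternating_mats_def eq_neg_iff_add_eq_0)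
qed (simp add: alternating_mats_def)

lemma bordered_mat_alternating:
  assumes "a \<in> carrier_vec n" "A \<in> alternating_mats n"
  shows "bordered_mat a A \<in> alternating_mats (Suc n)"
  using assms unfolding alternating_mats_iff
  by (auto simp: bordered_mat_def split: nat.split)

text \<open>An alternating matrix is determined by its first column below the diagonal and the
  remaining block. Sums over size \<open>n + 1\<close> are reindexed along this bijection.\<close>

lemma bij_betw_bordered_mat:
  "bij_betw (\<lambda>(a, A). bordered_mat a A) (carrier_vec n \<times> alternating_mats n)
     (alternating_mats (Suc n) :: 'a::field mat set)"
proof (rule bij_betwI')
  fix p p' :: "'a vec \<times> 'a mat"
  assume p: "p \<in> carrier_vec n \<times> alternating_mats n" "p' \<in> carrier_vec n \<times> alternating_mats n"
  show "((case p of (a, A) \<Rightarrow> bordered_mat a A) = (case p' of (a, A) \<Rightarrow> bordered_mat a A)) \<longleftrightarrow> p = p'"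
  proof
    assume e: "(case p of (a, A) \<Rightarrow> bordered_mat a A) = (case p' of (a, A) \<Rightarrow> bordered_mat a A)"
    obtain a A b B where ab: "p = (a, A)" "p' = (b, B)" by (cases p, cases p')
    have e': "bordered_mat a A $$ (i, j) = bordered_mat b B $$ (i, j)" for i j using e ab by simp
    have "a $ i = b $ i" if "i < n" for i
      using e'[of "Suc i" 0] that p ab by (auto simp: bordered_mat_def)
    moreover have "A $$ (i, j) = B $$ (i, j)" if "i < n" "j < n" for i j
      using e'[of "Suc i" "Suc j"] that p ab by (auto simp: bordered_mat_def)
    ultimately show "p = p'" using p ab by (auto simp: alternating_mats_def intro!: eq_vecI eq_matI)
  qed simp
next
  fix p :: "'a vec \<times> 'a mat" assume "p \<in> carrier_vec n \<times> alternating_mats n"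
  then show "(case p of (a, A) \<Rightarrow> bordered_mat a A) \<in> alternating_mats (Suc n)"
    by (auto intro: bordered_mat_alternating)
next
  fix M :: "'a mat" assume M: "M \<in> alternating_mats (Suc n)"
  define a where "a = vec n (\<lambda>i. M $$ (Suc i, 0))"
  define A where "A = mat n n (\<lambda>(i, j). M $$ (Suc i, Suc j))"
  have "A \<in> alternating_mats n"
    using M unfolding alternating_mats_iff A_def by simp
  moreover have "M = bordered_mat a A"
  proof (rule eq_matI)
    fix i j assume "i < dim_row (bordered_mat a A)" "j < dim_col (bordered_mat a A)"
    then have ij: "i < Suc n" "j < Suc n" by (simp_all add: bordered_mat_def a_def)
    have M0: "M $$ (0, Suc k) = - M $$ (Suc k, 0)" "M $$ (0, 0) = 0" if "k < n" for k
      using M that unfolding alternating_mats_iff by (simp_all add: eq_neg_iff_add_eq_0)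
    show "M $$ (i, j) = bordered_mat a A $$ (i, j)"
    proof (cases i)
      case 0
      then show ?thesis using ij M0 M
        by (cases j) (auto simp: bordered_mat_def a_def alternating_mats_def)
    qed (use ij in \<open>auto simp: bordered_mat_def a_def A_def split: nat.split\<close>)
  qed (use M in \<open>auto simp: bordered_mat_def alternating_mats_def a_def\<close>)
  moreover have "a \<in> carrier_vec n" by (simp add: a_def)
  ultimately show "\<exists>p\<in>carrier_vec n \<times> alternating_mats n. M = (case p of (a, A) \<Rightarrow> bordered_mat a A)"
    by auto
qed

lemma alternating_mats_0: "alternating_mats 0 = {0\<^sub>m 0 0}"
  by (auto simp: alternating_mats_def)

lemma alternating_mats_Suc_cases:
  assumes "M \<in> alternating_mats (Suc n)"
  obtains a A where "a \<in> carrier_vec n" "A \<in> alternating_mats n" "M = bordered_mat a A"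
  using assms unfolding bij_betw_imp_surj_on[OF bij_betw_bordered_mat, symmetric] by auto

lemma finite_alternating_mats: "finite (alternating_mats n :: 'a::{finite, field} mat set)"
proof (induction n)
  case (Suc n)
  then show ?case
    using bij_betw_finite[OF bij_betw_bordered_mat[of n, where 'a = 'a]] finite_carrier_vec by blast
qed (simp add: alternating_mats_0)

lemma zero_mat_alternating: "0\<^sub>m n n \<in> alternating_mats n"
  by (auto simp: alternating_mats_def)

lemma alternating_scalar_prod:
  assumes "A \<in> alternating_mats n" "u \<in> carrier_vec n" "w \<in> carrier_vec n"
  shows "u \<bullet> (A *\<^sub>v w) = - ((A *\<^sub>v u) \<bullet> w)"
proof -
  have A: "A \<in> carrier_mat n n" "transpose_mat A = - A" using assms by (auto simp: alternating_mats_def)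
  have "(transpose_mat A *\<^sub>v u) \<bullet> w = u \<bullet> (A *\<^sub>v w)"
    by (rule transpose_vec_mult_scalar[OF A(1) assms(3,2)])
  moreover have "(- A) *\<^sub>v u = - (A *\<^sub>v u)" using A assms by (simp add: uminus_mult_mat_vec)
  ultimately show ?thesis using A assms by (simp add: scalar_prod_uminus_left)
qed

text \<open>Induction along bordering: the two cross terms \<open>t * (a \<bullet> w)\<close>
  cancel, so no division by 2 occurs.\<close>

lemma alternating_isotropic:
  assumes A: "A \<in> alternating_mats n" and u: "u \<in> carrier_vec n"
  shows "u \<bullet> (A *\<^sub>v u) = 0"
  using A u
proof (induction n arbitrary: A u)
  case (Suc n)
  obtain a B where M: "a \<in> carrier_vec n" "B \<in> alternating_mats n" "A = bordered_mat a B"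
    using alternating_mats_Suc_cases[OF Suc.prems(1)] .
  obtain t w where u: "u = vCons t w" "w \<in> carrier_vec n"
    using Suc.prems(2) by (auto simp: carrier_vec_Suc)
  show ?case
    using M u Suc.IH[OF M(2) u(2)] alternating_mats_carrier[OF M(2)]
    by (simp add: bordered_mat_mult_vec scalar_prod_add_distrib[of _ n] comm_scalar_prod[of w n a])
qed (simp add: scalar_prod_def)

lemma trace_form_eq_sum:
  "\<lbrakk>A \<in> carrier_mat n n; B \<in> carrier_mat n n\<rbrakk> \<Longrightarrow>
     trace_form A B = (\<Sum>i<n. \<Sum>j<n. A $$ (j, i) * B $$ (j, i))"
  by (auto simp: trace_form_def mat_trace_def scalar_prod_def lessThan_atLeast0 intro!: sum.cong)

text \<open>The border enters once as a column and once as a row, hence the 2. This is where odd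
  characteristic matters: \<open>2 \<cdot>\<^sub>v a\<close> has to vanish only for
  \<open>a = 0\<close>.\<close>

lemma trace_form_bordered_mat:
  fixes a :: "'a::field vec"
  assumes "a \<in> carrier_vec n" "b \<in> carrier_vec n" "A \<in> carrier_mat n n" "B \<in> carrier_mat n n"
  shows "trace_form (bordered_mat a A) (bordered_mat b B) = (2 \<cdot>\<^sub>v a) \<bullet> b + trace_form A B"
  using assms
  by (simp add: trace_form_eq_sum[of _ "Suc n"] trace_form_eq_sum[of _ n] sum.lessThan_Suc_shift
      bordered_mat_def scalar_prod_def sum.distrib lessThan_atLeast0[symmetric] sum_distrib_left mult.assoc del: sum.lessThan_Suc)

section \<open>Ranks of bordered matrices\<close>

lemma two_le_CARD: "2 \<le> CARD('a::{finite, zero_neq_one})"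
proof -
  have "card {0, 1 :: 'a} \<le> CARD('a)" by (rule card_mono) auto
  then show ?thesis by simp
qed

lemma rank_eqI:
  fixes A B :: "'a::{finite, field} mat"
  assumes "A \<in> carrier_mat n m" "B \<in> carrier_mat n' m'"
    and "card (mat_range A) = CARD('a) ^ k * card (mat_range B)"
  shows "vec_space.rank n A = vec_space.rank n' B + k"
proof -
  have "CARD('a) ^ vec_space.rank n A = CARD('a) ^ (vec_space.rank n' B + k)"
    using assms(3) unfolding card_mat_range[OF assms(1)] card_mat_range[OF assms(2)]
    by (simp add: power_add)
  then show ?thesis using two_le_CARD[where 'a = 'a] by (simp add: power_inject_exp)
qed

lemma mat_range_bordered_mat:
  fixes B :: "'a::comm_ring_1 mat"
  assumes v: "v \<in> carrier_vec n" and B: "B \<in> carrier_mat n n"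
  shows "mat_range (bordered_mat v B) =
    (\<lambda>(t, w). vCons (- (v \<bullet> w)) (t \<cdot>\<^sub>v v + B *\<^sub>v w)) ` (UNIV \<times> carrier_vec n)"
  unfolding mat_range_eq[OF bordered_mat_carrier[OF v]] carrier_vec_Suc image_image
  by (rule image_cong) (auto simp: bordered_mat_mult_vec[OF v B])

text \<open>If \<open>v = B u\<close>, the new first coordinate of a vector in the range is \<open>u \<bullet> y\<close>, where \<open>y\<close> are the others.\<close>

lemma rank_bordered_mat_in_range:
  fixes B :: "'a::{finite, field} mat"
  assumes B: "B \<in> alternating_mats n" and v: "v \<in> mat_range B"
  shows "vec_space.rank (Suc n) (bordered_mat v B) = vec_space.rank n B"
proof -
  note Bc = alternating_mats_carrier[OF B]
  obtain u where u: "u \<in> carrier_vec n" "v = B *\<^sub>v u" using v unfolding mat_range_eq[OF Bc] by auto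
  have vc: "v \<in> carrier_vec n" using u Bc by auto
  have uv: "u \<bullet> v = 0" using alternating_isotropic[OF B u(1)] u by simp
  have uB: "u \<bullet> (B *\<^sub>v w) = - (v \<bullet> w)" if "w \<in> carrier_vec n" for w
    using alternating_scalar_prod[OF B u(1) that] u by simp
  have "mat_range (bordered_mat v B) = (\<lambda>y. vCons (u \<bullet> y) y) ` mat_range B" (is "?L = ?R")
  proof (intro equalityI subsetI)
    fix z assume "z \<in> ?L"
    then obtain t w where w: "w \<in> carrier_vec n" "z = vCons (- (v \<bullet> w)) (t \<cdot>\<^sub>v v + B *\<^sub>v w)"
      unfolding mat_range_bordered_mat[OF vc Bc] by auto
    let ?y = "t \<cdot>\<^sub>v v + B *\<^sub>v w"
    have "?y \<in> mat_range B"
    proof -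
      have "B *\<^sub>v w \<in> mat_range B" using w(1) unfolding mat_range_eq[OF Bc] by blast
      then show ?thesis using vec_subspace_mat_range[OF Bc] v by (simp add: vec_subspace_def)
    qed
    moreover have "u \<bullet> ?y = - (v \<bullet> w)"
      using u(1) vc Bc w(1) uv uB[OF w(1)] by (simp add: scalar_prod_add_distrib[of _ n])
    ultimately show "z \<in> ?R" using w by (auto intro!: image_eqI[of _ _ ?y])
  next
    fix z assume "z \<in> ?R"
    then obtain w where w: "w \<in> carrier_vec n" "z = vCons (u \<bullet> (B *\<^sub>v w)) (B *\<^sub>v w)"
      unfolding mat_range_eq[OF Bc] by auto
    then have "z = vCons (- (v \<bullet> w)) (0 \<cdot>\<^sub>v v + B *\<^sub>v w)"
      using uB vc Bc by auto
    then show "z \<in> ?L"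
      unfolding mat_range_bordered_mat[OF vc Bc] using w(1) by (intro image_eqI[of _ _ "(0, w)"]) simp_all
  qed
  then have "card (mat_range (bordered_mat v B)) = CARD('a) ^ 0 * card (mat_range B)"
    by (simp add: card_image inj_on_def)
  from rank_eqI[OF bordered_mat_carrier[OF vc] Bc this] show ?thesis by simp
qed

lemma rank_bordered_mat_zero:
  assumes "B \<in> alternating_mats n"
  shows "vec_space.rank (Suc n) (bordered_mat (0\<^sub>v n) B) = vec_space.rank n (B :: 'a::{finite, field} mat)"
  using rank_bordered_mat_in_range[OF assms]
    vec_subspace_mat_range[OF alternating_mats_carrier[OF assms]] by (simp add: vec_subspace_def)

lemma unit_vec_Suc_0: "unit_vec (Suc n) 0 = vCons 1 (0\<^sub>v n)"
  by (rule eq_vecI) (auto simp: vec_index_vCons)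

text \<open>The first two coordinates \<open>s\<close> and \<open>t\<close> of a vector in the range
  are arbitrary, and the others are \<open>y - s \<cdot>\<^sub>v a\<close> with \<open>y\<close> in
  the range of \<open>A\<close>. The vector \<open>a\<close> only shifts, so the range has
  \<open>CARD('a) ^ 2\<close> times as many elements.\<close>

lemma rank_bordered_mat_unit:
  fixes A :: "'a::{finite, field} mat"
  assumes a: "a \<in> carrier_vec n" and A: "A \<in> alternating_mats n"
  shows "vec_space.rank (Suc (Suc n)) (bordered_mat (unit_vec (Suc n) 0) (bordered_mat a A)) =
    vec_space.rank n A + 2"
proof -
  note Ac = alternating_mats_carrier[OF A]
  let ?M = "bordered_mat (unit_vec (Suc n) 0) (bordered_mat a A)"
  let ?f = "\<lambda>(s, t, y). vCons s (vCons t (y - s \<cdot>\<^sub>v a))"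
  have M: "?M \<in> carrier_mat (Suc (Suc n)) (Suc (Suc n))" by simp
  have mult: "?M *\<^sub>v vCons t (vCons s w) = vCons (- s) (vCons (t - a \<bullet> w) (A *\<^sub>v w - (- s) \<cdot>\<^sub>v a))"
    if w: "w \<in> carrier_vec n" for s t w
  proof -
    have c: "vCons s w \<in> carrier_vec (Suc n)" using w by simp
    have i: "unit_vec (Suc n) 0 \<bullet> vCons s w = s" using w by (simp add: unit_vec_Suc_0)
    have "?M *\<^sub>v vCons t (vCons s w) =
        vCons (- s) (t \<cdot>\<^sub>v unit_vec (Suc n) 0 + vCons (- (a \<bullet> w)) (s \<cdot>\<^sub>v a + A *\<^sub>v w))"
      unfolding bordered_mat_mult_vec[OF unit_vec_carrier bordered_mat_carrier[OF a] c] i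
        bordered_mat_mult_vec[OF a Ac w] ..
    also have "t \<cdot>\<^sub>v unit_vec (Suc n) 0 + vCons (- (a \<bullet> w)) (s \<cdot>\<^sub>v a + A *\<^sub>v w) =
        vCons (t - a \<bullet> w) (A *\<^sub>v w - (- s) \<cdot>\<^sub>v a)"
      unfolding unit_vec_Suc_0 by (rule eq_vecI) (use a Ac w in \<open>auto simp: vec_index_vCons\<close>)
    finally show ?thesis .
  qed
  have "mat_range ?M = ?f ` (UNIV \<times> UNIV \<times> mat_range A)" (is "?L = ?R")
  proof (intro equalityI subsetI)
    fix z assume "z \<in> ?L"
    then obtain t s w where w: "w \<in> carrier_vec n" "z = ?M *\<^sub>v vCons t (vCons s w)"
      unfolding mat_range_eq[OF M] by (auto simp: carrier_vec_Suc)
    then show "z \<in> ?R" unfolding w(2) mult[OF w(1)] mat_range_eq[OF Ac]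
      by (auto intro!: image_eqI[of _ _ "(- s, t - a \<bullet> w, A *\<^sub>v w)"])
  next
    fix z assume "z \<in> ?R"
    then obtain s t w where w: "w \<in> carrier_vec n" "z = vCons s (vCons t (A *\<^sub>v w - s \<cdot>\<^sub>v a))"
      unfolding mat_range_eq[OF Ac] by auto
    then have "z = ?M *\<^sub>v vCons (t + a \<bullet> w) (vCons (- s) w)" unfolding mult[OF w(1)] by simp
    then show "z \<in> ?L" unfolding mat_range_eq[OF M] using w by (auto intro!: image_eqI)
  qed
  moreover have "inj_on ?f (UNIV \<times> UNIV \<times> mat_range A)"
  proof -
    have "y = y'" if "y - s \<cdot>\<^sub>v a = y' - s \<cdot>\<^sub>v a" "y \<in> carrier_vec n" "y' \<in> carrier_vec n" for y y' s
    proof (rule eq_vecI)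
      fix i assume "i < dim_vec y'"
      then show "y $ i = y' $ i" using arg_cong[OF that(1), of "\<lambda>v. v $ i"] that(2,3) a by simp
    qed (use that in auto)
    then show ?thesis using mat_range_carrier[OF Ac] by (auto simp: inj_on_def)
  qed
  ultimately have "card (mat_range ?M) = CARD('a) ^ 2 * card (mat_range A)"
    by (simp add: card_image card_cartesian_product power2_eq_square)
  from rank_eqI[OF M Ac this] show ?thesis .
qed

lemma rank_0_iff:
  fixes A :: "'a::{finite, field} mat"
  assumes A: "A \<in> carrier_mat n m"
  shows "vec_space.rank n A = 0 \<longleftrightarrow> A = 0\<^sub>m n m"
proof
  assume "vec_space.rank n A = 0"
  then have "card (mat_range A) = 1" using card_mat_range[OF A] by simp
  moreover have "0\<^sub>v n \<in> mat_range A"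
    using vec_subspace_mat_range[OF A] by (simp add: vec_subspace_def)
  ultimately have "mat_range A = {0\<^sub>v n}" by (metis card_1_singletonE singletonD)
  then have *: "A *\<^sub>v unit_vec m j = 0\<^sub>v n" if "j < m" for j
    unfolding mat_range_eq[OF A] by auto
  show "A = 0\<^sub>m n m"
  proof (rule eq_matI)
    fix i j assume "i < dim_row (0\<^sub>m n m :: 'a mat)" "j < dim_col (0\<^sub>m n m :: 'a mat)"
    then have ij: "i < n" "j < m" by simp_all
    have "A $$ (i, j) = (A *\<^sub>v unit_vec m j) $ i" using A ij by simp
    then show "A $$ (i, j) = 0\<^sub>m n m $$ (i, j)" using * ij by simp
  qed (use A in auto)
next
  assume "A = 0\<^sub>m n m"
  then have "mat_range A = {0\<^sub>v n}" by (auto simp: mat_range_def intro!: image_eqI[of _ _ "0\<^sub>v m"])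
  then have "CARD('a) ^ vec_space.rank n A = CARD('a) ^ 0" using card_mat_range[OF A] by simp
  then show "vec_space.rank n A = 0"
    using two_le_CARD[where 'a = 'a] power_inject_exp[of "CARD('a)" "vec_space.rank n A" 0] by simp
qed

context additive_character
begin

text \<open>Since the range of \<open>B\<close> is its own double complement, some \<open>k\<close>
  orthogonal to it has \<open>v \<bullet> k \<noteq> 0\<close>, and \<open>B\<close> kills
  \<open>k\<close> by skew-symmetry. Adding multiples of \<open>k\<close> to the argument changes
  the first coordinate freely and nothing else; the multiples of \<open>v\<close> give the second
  new dimension.\<close>

lemma rank_bordered_mat_not_in_range:
  assumes B: "B \<in> alternating_mats n" and vc: "v \<in> carrier_vec n" and v: "v \<notin> mat_range B"
  shows "vec_space.rank (Suc n) (bordered_mat v B) = vec_space.rank n (B :: 'a mat) + 2"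
proof -
  note Bc = alternating_mats_carrier[OF B] and H = vec_subspace_mat_range[OF alternating_mats_carrier[OF B]]
  obtain k where k: "k \<in> orthogonal_complement n (mat_range B)" "v \<bullet> k \<noteq> 0"
    using v vc orthogonal_complement_twice[OF H] by (auto simp: orthogonal_complement_def)
  then have kc: "k \<in> carrier_vec n" by (simp add: orthogonal_complement_def)
  have Bk: "B *\<^sub>v k = 0\<^sub>v n"
  proof (rule scalar_prod_eq_0_carrier)
    show "\<forall>w\<in>carrier_vec n. (B *\<^sub>v k) \<bullet> w = 0"
      using k alternating_scalar_prod[OF B kc] unfolding orthogonal_complement_def mat_range_eq[OF Bc] by force
  qed (use Bc kc in simp)
  let ?f = "\<lambda>(s, t, y). vCons s (t \<cdot>\<^sub>v v + y)"
  have "mat_range (bordered_mat v B) = ?f ` (UNIV \<times> UNIV \<times> mat_range B)" (is "?L = ?R")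
  proof (intro equalityI subsetI)
    fix z assume "z \<in> ?L"
    then obtain t w where w: "w \<in> carrier_vec n" "z = vCons (- (v \<bullet> w)) (t \<cdot>\<^sub>v v + B *\<^sub>v w)"
      unfolding mat_range_bordered_mat[OF vc Bc] by auto
    then show "z \<in> ?R" unfolding mat_range_eq[OF Bc]
      by (intro image_eqI[of _ _ "(- (v \<bullet> w), t, B *\<^sub>v w)"]) simp_all
  next
    fix z assume "z \<in> ?R"
    then obtain s t w where w: "w \<in> carrier_vec n" "z = vCons s (t \<cdot>\<^sub>v v + B *\<^sub>v w)"
      unfolding mat_range_eq[OF Bc] by auto
    \<comment> \<open>The multiple of \<open>k\<close> that brings the first coordinate
      \<open>- (v \<bullet> w')\<close> to the prescribed value \<open>s\<close>.\<close>
    define c where "c = - (s + v \<bullet> w) / (v \<bullet> k)"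
    define w' where "w' = w + c \<cdot>\<^sub>v k"
    have w'c: "w' \<in> carrier_vec n" using w kc by (simp add: w'_def)
    have "- (v \<bullet> w') = s"
      using w kc vc k(2) by (simp add: w'_def scalar_prod_add_distrib[of _ n] c_def)
    moreover have "B *\<^sub>v w' = B *\<^sub>v w"
    proof -
      have "B *\<^sub>v w' = B *\<^sub>v w + c \<cdot>\<^sub>v 0\<^sub>v n"
        using w kc Bc Bk by (simp add: w'_def mult_add_distrib_mat_vec[of _ n n] mult_mat_vec[of _ n n])
      also have "\<dots> = B *\<^sub>v w" by (rule eq_vecI) (use Bc in auto)
      finally show ?thesis .
    qed
    ultimately have "z = vCons (- (v \<bullet> w')) (t \<cdot>\<^sub>v v + B *\<^sub>v w')" using w by simp
    then show "z \<in> ?L"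
      unfolding mat_range_bordered_mat[OF vc Bc] using w'c by (intro image_eqI[of _ _ "(t, w')"]) simp_all
  qed
  moreover have "inj_on ?f (UNIV \<times> UNIV \<times> mat_range B)"
  proof -
    have "t = t' \<and> y = y'" if e: "t \<cdot>\<^sub>v v + y = t' \<cdot>\<^sub>v v + y'" and y: "y \<in> mat_range B" "y' \<in> mat_range B" for t t' y y'
    proof -
      have yc: "y \<in> carrier_vec n" "y' \<in> carrier_vec n" using y mat_range_carrier[OF Bc] by auto
      have ei: "t * v $ i + y $ i = t' * v $ i + y' $ i" if "i < n" for i
        using arg_cong[OF e, of "\<lambda>u. u $ i"] that yc vc by simp
      have "t = t'"
      proof (rule ccontr)
        assume "t \<noteq> t'"
        \<comment> \<open>Different coefficients would exhibit \<open>v\<close> as a combination of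
          vectors in the range of \<open>B\<close>.\<close>
        then have "v = (1 / (t - t')) \<cdot>\<^sub>v (y' + (- 1) \<cdot>\<^sub>v y)"
          using ei yc vc by (intro eq_vecI) (auto simp: field_simps)
        then show False using v y H unfolding vec_subspace_def by auto
      qed
      then show ?thesis using ei yc by (auto intro!: eq_vecI)
    qed
    then show ?thesis by (auto simp: inj_on_def)
  qed
  ultimately have "card (mat_range (bordered_mat v B)) = CARD('a) ^ 2 * card (mat_range B)"
    by (simp add: card_image card_cartesian_product power2_eq_square)
  from rank_eqI[OF bordered_mat_carrier[OF vc] Bc this] show ?thesis .
qed

section \<open>Character sums over bordered matrices\<close>

definition alternating_char_sum :: "nat \<Rightarrow> 'a mat \<Rightarrow> nat \<Rightarrow> complex" where
  "alternating_char_sum n A r = (\<Sum>B\<in>alternating_mats_of_rank n r. \<chi> (trace_form A B))"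

definition annihilating_char_sum :: "nat \<Rightarrow> 'a mat \<Rightarrow> 'a vec \<Rightarrow> nat \<Rightarrow> complex" where
  "annihilating_char_sum n A a r =
     (\<Sum>B | B \<in> alternating_mats_of_rank n r \<and> B *\<^sub>v a = 0\<^sub>v n. \<chi> (trace_form A B))"

text \<open>By skew-symmetry \<open>a\<close> is orthogonal to the range of \<open>B\<close> exactly
  if \<open>B *\<^sub>v a\<close> is zero, and the range has \<open>CARD('a) ^ rank\<close>
  elements.\<close>

lemma sum_char_mat_range:
  assumes B: "B \<in> alternating_mats n" and a: "a \<in> carrier_vec n"
  shows "(\<Sum>v\<in>mat_range B. \<chi> (a \<bullet> v)) = (if B *\<^sub>v a = 0\<^sub>v n then of_nat CARD('a) ^ vec_space.rank n B else 0)"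
proof -
  note Bc = alternating_mats_carrier[OF B]
  have Ba: "B *\<^sub>v a \<in> carrier_vec n" using Bc a by simp
  have "(\<forall>v\<in>mat_range B. a \<bullet> v = 0) \<longleftrightarrow> (\<forall>w\<in>carrier_vec n. (B *\<^sub>v a) \<bullet> w = 0)"
    unfolding mat_range_eq[OF Bc] using alternating_scalar_prod[OF B a] by auto
  also have "\<dots> \<longleftrightarrow> B *\<^sub>v a = 0\<^sub>v n" using scalar_prod_eq_0_carrier[OF Ba] by auto
  finally show ?thesis
    unfolding sum_char_subspace[OF vec_subspace_mat_range[OF Bc] a] card_mat_range[OF Bc] by simp
qed

text \<open>Rank \<open>r + 2\<close> arises either from a block of rank \<open>r + 2\<close> with
  the border in its range, or from a block of rank \<open>r\<close> with the border outside. The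
  second sum is the one over the whole space minus the one over the range.\<close>

lemma sum_char_bordered_rank:
  assumes B: "B \<in> alternating_mats n" and a: "a \<in> carrier_vec n"
  shows "(\<Sum>b\<in>carrier_vec n. if vec_space.rank (Suc n) (bordered_mat b B) = Suc (Suc r) then \<chi> (a \<bullet> b) else 0) =
     (if vec_space.rank n B = Suc (Suc r) \<and> B *\<^sub>v a = 0\<^sub>v n then of_nat CARD('a) ^ Suc (Suc r) else 0) +
     (if vec_space.rank n B = r then
        (if a = 0\<^sub>v n then of_nat CARD('a) ^ n else 0) - (if B *\<^sub>v a = 0\<^sub>v n then of_nat CARD('a) ^ r else 0) else 0)"
proof -
  note Bc = alternating_mats_carrier[OF B]
  let ?V = "carrier_vec n :: 'a vec set" and ?H = "mat_range B" and ?k = "vec_space.rank n B"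
  have HV: "?H \<subseteq> ?V" using mat_range_carrier[OF Bc] .
  have "(\<Sum>b\<in>?V. if vec_space.rank (Suc n) (bordered_mat b B) = Suc (Suc r) then \<chi> (a \<bullet> b) else 0) =
     (\<Sum>b\<in>?H. if ?k = Suc (Suc r) then \<chi> (a \<bullet> b) else 0) + (\<Sum>b\<in>?V - ?H. if ?k = r then \<chi> (a \<bullet> b) else 0)"
    unfolding sum.subset_diff[OF HV finite_carrier_vec, of "\<lambda>b. if vec_space.rank (Suc n) (bordered_mat b B) = Suc (Suc r) then \<chi> (a \<bullet> b) else 0"]
    by (subst add.commute, intro arg_cong2[of _ _ _ _ "(+)"] sum.cong refl)
       (auto simp: rank_bordered_mat_in_range[OF B] rank_bordered_mat_not_in_range[OF B])
  moreover have "(\<Sum>b\<in>?V - ?H. \<chi> (a \<bullet> b)) = (\<Sum>b\<in>?V. \<chi> (a \<bullet> b)) - (\<Sum>b\<in>?H. \<chi> (a \<bullet> b))"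
    by (rule sum_diff[OF finite_carrier_vec HV])
  moreover have "(\<Sum>b\<in>?V. \<chi> (a \<bullet> b)) = (if a = 0\<^sub>v n then of_nat CARD('a) ^ n else 0)"
  proof -
    have "(\<forall>v\<in>?V. a \<bullet> v = 0) \<longleftrightarrow> a = 0\<^sub>v n"
      using scalar_prod_eq_0_carrier[OF a] scalar_prod_left_zero by blast
    then show ?thesis
      unfolding sum_char_subspace[OF vec_subspace_carrier a] card_carrier_vec by simp
  qed
  ultimately show ?thesis using sum_char_mat_range[OF B a]
    by (cases "?k = Suc (Suc r)"; cases "?k = r") simp_all
qed

lemma alternating_char_sum_bordered_mat:
  assumes two: "(2 :: 'a) \<noteq> 0" and a: "a \<in> carrier_vec n" and A: "A \<in> alternating_mats n"
  shows "alternating_char_sum (Suc n) (bordered_mat a A) (Suc (Suc r)) =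
     of_nat CARD('a) ^ Suc (Suc r) * annihilating_char_sum n A a (Suc (Suc r)) +
     (if a = 0\<^sub>v n then of_nat CARD('a) ^ n else 0) * alternating_char_sum n A r -
     of_nat CARD('a) ^ r * annihilating_char_sum n A a r"
proof -
  let ?X = "alternating_mats n :: 'a mat set" and ?q = "of_nat CARD('a) :: complex"
  \<comment> \<open>The character sees the doubled border; \<open>c0\<close> and \<open>Bc\<close>
    return to \<open>a\<close>, as 2 is invertible.\<close>
  let ?c = "2 \<cdot>\<^sub>v a"
  note Ac = alternating_mats_carrier[OF A]
  have fin: "finite ?X" by (rule finite_alternating_mats)
  have c: "?c \<in> carrier_vec n" using a by simp
  have c0: "?c = 0\<^sub>v n \<longleftrightarrow> a = 0\<^sub>v n"
    using two a by (auto simp: vec_eq_iff)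
  have Bc: "B *\<^sub>v ?c = 0\<^sub>v n \<longleftrightarrow> B *\<^sub>v a = 0\<^sub>v n" if "B \<in> ?X" for B
    using two a alternating_mats_carrier[OF that] by (auto simp: vec_eq_iff mult_mat_vec[of _ n n])
  have "alternating_char_sum (Suc n) (bordered_mat a A) (Suc (Suc r)) =
      (\<Sum>M\<in>alternating_mats (Suc n). if vec_space.rank (Suc n) M = Suc (Suc r) then \<chi> (trace_form (bordered_mat a A) M) else 0)"
    unfolding alternating_char_sum_def alternating_mats_of_rank_def
    by (rule sum.inter_filter[OF finite_alternating_mats])
  also have "\<dots> = (\<Sum>(b, B)\<in>carrier_vec n \<times> ?X. if vec_space.rank (Suc n) (bordered_mat b B) = Suc (Suc r)
      then \<chi> (trace_form (bordered_mat a A) (bordered_mat b B)) else 0)"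
    unfolding sum.reindex_bij_betw[OF bij_betw_bordered_mat, symmetric] by (rule sum.cong) auto
  also have "\<dots> = (\<Sum>B\<in>?X. \<Sum>b\<in>carrier_vec n. if vec_space.rank (Suc n) (bordered_mat b B) = Suc (Suc r)
      then \<chi> (trace_form (bordered_mat a A) (bordered_mat b B)) else 0)"
    unfolding sum.cartesian_product[symmetric] by (rule sum.swap)
  also have "\<dots> = (\<Sum>B\<in>?X. \<chi> (trace_form A B) * (\<Sum>b\<in>carrier_vec n.
      if vec_space.rank (Suc n) (bordered_mat b B) = Suc (Suc r) then \<chi> (?c \<bullet> b) else 0))"
    unfolding sum_distrib_left
    by (intro sum.cong refl)
       (simp add: trace_form_bordered_mat[OF a _ Ac] alternating_mats_carrier char_add)
  also have "\<dots> = (\<Sum>B\<in>?X. \<chi> (trace_form A B) * (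
     (if vec_space.rank n B = Suc (Suc r) \<and> B *\<^sub>v a = 0\<^sub>v n then ?q ^ Suc (Suc r) else 0) +
     (if vec_space.rank n B = r then
        (if a = 0\<^sub>v n then ?q ^ n else 0) - (if B *\<^sub>v a = 0\<^sub>v n then ?q ^ r else 0) else 0)))"
    by (intro sum.cong refl) (simp only: sum_char_bordered_rank[OF _ c] c0 Bc)
  also have "\<dots> = (\<Sum>B\<in>?X. ?q ^ Suc (Suc r) * (if vec_space.rank n B = Suc (Suc r) \<and> B *\<^sub>v a = 0\<^sub>v n then \<chi> (trace_form A B) else 0)
      + (if a = 0\<^sub>v n then ?q ^ n else 0) * (if vec_space.rank n B = r then \<chi> (trace_form A B) else 0)
      - ?q ^ r * (if vec_space.rank n B = r \<and> B *\<^sub>v a = 0\<^sub>v n then \<chi> (trace_form A B) else 0))"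
    by (intro sum.cong refl) (simp add: algebra_simps)
  finally show ?thesis
    by (simp only: sum.distrib sum_subtractf sum_distrib_left[symmetric] alternating_char_sum_def
        annihilating_char_sum_def alternating_mats_of_rank_def mem_Collect_eq conj_assoc sum.inter_filter[OF fin])
qed

text \<open>Every matrix annihilates the zero vector, so all three sums in the general formula are
  full character sums.\<close>

lemma alternating_char_sum_bordered_mat_zero:
  assumes "(2 :: 'a) \<noteq> 0" and A: "A \<in> alternating_mats n"
  shows "alternating_char_sum (Suc n) (bordered_mat (0\<^sub>v n) A) (Suc (Suc r)) =
     of_nat CARD('a) ^ Suc (Suc r) * alternating_char_sum n A (Suc (Suc r)) +
     (of_nat CARD('a) ^ n - of_nat CARD('a) ^ r) * alternating_char_sum n A r"
proof -
  have "B *\<^sub>v 0\<^sub>v n = 0\<^sub>v n" if "B \<in> alternating_mats_of_rank n k" for B :: "'a mat" and k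
    using that by (intro eq_vecI) (auto simp: alternating_mats_of_rank_def alternating_mats_def)
  then have "annihilating_char_sum n A (0\<^sub>v n) k = alternating_char_sum n A k" for k
    unfolding annihilating_char_sum_def alternating_char_sum_def by (intro sum.cong) auto
  then show ?thesis
    using alternating_char_sum_bordered_mat[OF assms(1) zero_carrier_vec A] by (simp add: algebra_simps)
qed

text \<open>A bordered matrix annihilates the first unit vector only if its border is zero. The
  annihilating sums of size \<open>n + 1\<close> are therefore full sums of size \<open>n\<close>,
  where \<open>a\<close> is paired with a zero border and drops out. The middle term of the general
  formula vanishes because the unit vector is nonzero.\<close>

lemma alternating_char_sum_bordered_mat_unit:
  assumes "(2 :: 'a) \<noteq> 0" and a: "a \<in> carrier_vec n" and A: "A \<in> alternating_mats n"
  shows "alternating_char_sum (Suc (Suc n)) (bordered_mat (unit_vec (Suc n) 0) (bordered_mat a A)) (Suc (Suc r)) =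
     of_nat CARD('a) ^ Suc (Suc r) * alternating_char_sum n A (Suc (Suc r)) -
     of_nat CARD('a) ^ r * alternating_char_sum n A r"
proof -
  let ?e = "unit_vec (Suc n) 0 :: 'a vec"
  note Ac = alternating_mats_carrier[OF A]
  have kernel: "bordered_mat b B *\<^sub>v ?e = 0\<^sub>v (Suc n) \<longleftrightarrow> b = 0\<^sub>v n"
    if b: "b \<in> carrier_vec n" and B: "B \<in> carrier_mat n n" for b B
  proof -
    have "1 \<cdot>\<^sub>v b + B *\<^sub>v 0\<^sub>v n = b" by (rule eq_vecI) (use b B in auto)
    then show ?thesis
      unfolding unit_vec_Suc_0 bordered_mat_mult_vec[OF b B zero_carrier_vec] using b
      by (simp add: zero_vec_Suc)
  qed
  have red: "annihilating_char_sum (Suc n) (bordered_mat a A) ?e k = alternating_char_sum n A k" for k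
  proof -
    have "{M. M \<in> alternating_mats_of_rank (Suc n) k \<and> M *\<^sub>v ?e = 0\<^sub>v (Suc n)} =
        bordered_mat (0\<^sub>v n) ` alternating_mats_of_rank n k" (is "?L = ?R")
    proof (intro equalityI subsetI)
      fix M assume M: "M \<in> ?L"
      then obtain b B where "b \<in> carrier_vec n" "B \<in> alternating_mats n" "M = bordered_mat b B"
        unfolding alternating_mats_of_rank_def by (blast elim: alternating_mats_Suc_cases)
      moreover from this M have "b = 0\<^sub>v n" using kernel alternating_mats_carrier by blast
      ultimately show "M \<in> ?R" using M by (auto simp: alternating_mats_of_rank_def rank_bordered_mat_zero)
    next
      fix M assume "M \<in> ?R"
      then show "M \<in> ?L"
        by (auto simp: alternating_mats_of_rank_def rank_bordered_mat_zero bordered_mat_alternating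
            kernel alternating_mats_carrier)
    qed
    moreover have "inj_on (bordered_mat (0\<^sub>v n)) (alternating_mats_of_rank n k :: 'a mat set)"
    proof (rule inj_onI)
      fix B C :: "'a mat"
      assume "B \<in> alternating_mats_of_rank n k" "C \<in> alternating_mats_of_rank n k"
        and "bordered_mat (0\<^sub>v n) B = bordered_mat (0\<^sub>v n) C"
      then show "B = C"
        using inj_onD[OF bij_betw_imp_inj_on[OF bij_betw_bordered_mat[of n, where 'a = 'a]], of "(0\<^sub>v n, B)" "(0\<^sub>v n, C)"]
        by (simp add: alternating_mats_of_rank_def)
    qed
    ultimately have "annihilating_char_sum (Suc n) (bordered_mat a A) ?e k =
        (\<Sum>B\<in>alternating_mats_of_rank n k. \<chi> (trace_form (bordered_mat a A) (bordered_mat (0\<^sub>v n) B)))"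
      unfolding annihilating_char_sum_def by (simp add: sum.reindex)
    also have "\<dots> = alternating_char_sum n A k"
      unfolding alternating_char_sum_def
      by (intro sum.cong refl arg_cong[of _ _ \<chi>])
         (use a Ac in \<open>simp add: trace_form_bordered_mat alternating_mats_of_rank_def alternating_mats_carrier\<close>)
    finally show ?thesis .
  qed
  have "?e \<noteq> 0\<^sub>v (Suc n)" by (simp add: unit_vec_Suc_0 zero_vec_Suc)
  then show ?thesis
    using alternating_char_sum_bordered_mat[OF assms(1) unit_vec_carrier bordered_mat_alternating[OF a A]]
    by (simp add: red)
qed

lemma alternating_char_sum_rank_0:
  assumes "A \<in> carrier_mat n n"
  shows "alternating_char_sum n A 0 = 1"
proof -
  have "alternating_mats_of_rank n 0 = {0\<^sub>m n n :: 'a mat}"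
  proof (intro equalityI subsetI)
    fix B :: "'a mat" assume "B \<in> alternating_mats_of_rank n 0"
    then show "B \<in> {0\<^sub>m n n}"
      using rank_0_iff[OF alternating_mats_carrier] by (auto simp: alternating_mats_of_rank_def)
  next
    fix B :: "'a mat" assume "B \<in> {0\<^sub>m n n}"
    then show "B \<in> alternating_mats_of_rank n 0"
      using rank_0_iff[of B n n] zero_mat_alternating[of n] by (simp add: alternating_mats_of_rank_def)
  qed
  moreover have "trace_form A (0\<^sub>m n n) = 0" using assms by (simp add: trace_form_eq_sum)
  ultimately show ?thesis by (simp add: alternating_char_sum_def)
qed

end

subsection \<open>Congruence\<close>

lemma mat_trace_mult_commute:
  fixes A B :: "'a::comm_ring_1 mat"
  assumes "A \<in> carrier_mat n m" "B \<in> carrier_mat m n"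
  shows "mat_trace (A * B) = mat_trace (B * A)"
proof -
  have "mat_trace (A * B) = (\<Sum>i<n. \<Sum>j<m. A $$ (i, j) * B $$ (j, i))"
    using assms by (auto simp: mat_trace_def scalar_prod_def lessThan_atLeast0 intro!: sum.cong)
  also have "\<dots> = (\<Sum>j<m. \<Sum>i<n. B $$ (j, i) * A $$ (i, j))"
    by (subst sum.swap) (simp add: mult.commute)
  also have "\<dots> = mat_trace (B * A)"
    using assms by (auto simp: mat_trace_def scalar_prod_def lessThan_atLeast0 intro!: sum.cong)
  finally show ?thesis .
qed

text \<open>The inverse is carried along as a second matrix, so that transposes and direct sums come
  with explicit inverses.\<close>

definition inverse_mats :: "nat \<Rightarrow> 'a::semiring_1 mat \<Rightarrow> 'a mat \<Rightarrow> bool" where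
  "inverse_mats n P Q \<longleftrightarrow> P \<in> carrier_mat n n \<and> Q \<in> carrier_mat n n \<and> P * Q = 1\<^sub>m n \<and> Q * P = 1\<^sub>m n"

lemma inverse_mats_transpose:
  fixes P Q :: "'a::comm_semiring_1 mat"
  assumes "inverse_mats n P Q"
  shows "inverse_mats n (transpose_mat P) (transpose_mat Q)"
  using assms unfolding inverse_mats_def
  by (auto simp flip: transpose_mult[of _ n n _ n])

lemma inverse_mats_sym: "inverse_mats n P Q \<Longrightarrow> inverse_mats n Q P"
  by (simp add: inverse_mats_def)

lemma inverse_mats_cancel_vec:
  fixes P Q :: "'a::comm_ring_1 mat"
  assumes "inverse_mats n P Q" "v \<in> carrier_vec n"
  shows "P *\<^sub>v (Q *\<^sub>v v) = v"
  using assms by (simp add: inverse_mats_def flip: assoc_mult_mat_vec[of _ n n _ n])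

lemma congruence_carrier [simp]:
  "P \<in> carrier_mat n n \<Longrightarrow> A \<in> carrier_mat n n \<Longrightarrow> P * A * transpose_mat P \<in> carrier_mat n n"
  by simp

lemma congruence_index:
  fixes P A :: "'a::comm_ring_1 mat"
  assumes P: "P \<in> carrier_mat n n" and A: "A \<in> carrier_mat n n" and i: "i < n" and j: "j < n"
  shows "(P * A * transpose_mat P) $$ (i, j) = row P i \<bullet> (A *\<^sub>v row P j)"
proof -
  have "P * A * transpose_mat P = P * (A * transpose_mat P)"
    using P A by (simp add: assoc_mult_mat[of _ n n _ n _ n])
  moreover have "(P * (A * transpose_mat P)) $$ (i, j) = row P i \<bullet> col (A * transpose_mat P) j"
    using assms by (intro index_mult_mat(1)) simp_all
  moreover have "col (A * transpose_mat P) j = A *\<^sub>v col (transpose_mat P) j"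
    by (rule col_mult2[of _ n n _ n]) (use assms in simp_all)
  ultimately show ?thesis using P j by simp
qed

text \<open>By \<open>congruence_index\<close> the entries are values of the form of
  \<open>A\<close> at pairs of rows of \<open>P\<close>, so skew-symmetry and isotropy of that form
  suffice.\<close>

lemma congruence_alternating:
  fixes P A :: "'a::field mat"
  assumes P: "P \<in> carrier_mat n n" and A: "A \<in> alternating_mats n"
  shows "P * A * transpose_mat P \<in> alternating_mats n"
proof -
  note Ac = alternating_mats_carrier[OF A]
  have r: "row P i \<in> carrier_vec n" if "i < n" for i using P that by simp
  have "row P j \<bullet> (A *\<^sub>v row P i) + row P i \<bullet> (A *\<^sub>v row P j) = 0" if "i < n" "j < n" for i j
    using alternating_scalar_prod[OF A r[OF that(1)] r[OF that(2)]]
      comm_scalar_prod[of "A *\<^sub>v row P i" n "row P j"] Ac r that by simp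
  moreover define M where "M = P * A * transpose_mat P"
  have "M $$ (i, j) = row P i \<bullet> (A *\<^sub>v row P j)" if "i < n" "j < n" for i j
    unfolding M_def by (rule congruence_index[OF P Ac that])
  moreover have "M \<in> carrier_mat n n" unfolding M_def using P Ac by simp
  ultimately show ?thesis
    unfolding alternating_mats_iff M_def[symmetric] using alternating_isotropic[OF A r] by simp
qed

lemma congruence_mult_vec:
  fixes P A :: "'a::field mat"
  assumes "P \<in> carrier_mat n n" "A \<in> carrier_mat n n" "w \<in> carrier_vec n"
  shows "(P * A * transpose_mat P) *\<^sub>v w = P *\<^sub>v (A *\<^sub>v (transpose_mat P *\<^sub>v w))"
  using assms by (simp add: assoc_mult_mat_vec[of _ n n _ n])

text \<open>The transpose of \<open>P\<close> permutes the arguments and \<open>P\<close> is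
  injective on the range of \<open>A\<close>, so both ranges have equal size.\<close>

lemma rank_congruence:
  fixes P A :: "'a::{finite, field} mat"
  assumes PQ: "inverse_mats n P Q" and A: "A \<in> carrier_mat n n"
  shows "vec_space.rank n (P * A * transpose_mat P) = vec_space.rank n A"
proof -
  have P: "P \<in> carrier_mat n n" "transpose_mat P \<in> carrier_mat n n" and Q: "transpose_mat Q \<in> carrier_mat n n"
    using PQ by (auto simp: inverse_mats_def)
  note PQt = inverse_mats_transpose[OF PQ]
  have "mat_range (P * A * transpose_mat P) = (\<lambda>v. P *\<^sub>v v) ` mat_range A"
  proof -
    have "(\<lambda>w. transpose_mat P *\<^sub>v w) ` carrier_vec n = carrier_vec n"
    proof (intro equalityI subsetI)
      fix v :: "'a vec" assume "v \<in> carrier_vec n"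
      then show "v \<in> (\<lambda>w. transpose_mat P *\<^sub>v w) ` carrier_vec n"
        using inverse_mats_cancel_vec[OF PQt, of v] Q by (intro image_eqI[of _ _ "transpose_mat Q *\<^sub>v v"]) simp_all
    qed (use P in auto)
    then have "mat_range A = (\<lambda>w. A *\<^sub>v (transpose_mat P *\<^sub>v w)) ` carrier_vec n"
      unfolding mat_range_eq[OF A] by (metis image_image)
    then show ?thesis
      unfolding mat_range_eq[OF congruence_carrier[OF P(1) A]]
      using congruence_mult_vec[OF P(1) A] by (simp add: image_image cong: image_cong)
  qed
  moreover have "inj_on (\<lambda>v. P *\<^sub>v v) (mat_range A)"
    using inverse_mats_cancel_vec[OF inverse_mats_sym[OF PQ]] mat_range_carrier[OF A]
    by (metis (no_types, lifting) inj_onI subsetD)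
  ultimately have "card (mat_range (P * A * transpose_mat P)) = CARD('a) ^ 0 * card (mat_range A)"
    by (simp add: card_image)
  from rank_eqI[OF congruence_carrier[OF P(1) A] A this] show ?thesis by simp
qed

lemma trace_form_congruence:
  fixes P A B :: "'a::field mat"
  assumes P: "P \<in> carrier_mat n n" and A: "A \<in> carrier_mat n n" and B: "B \<in> carrier_mat n n"
  shows "trace_form (P * A * transpose_mat P) B = trace_form A (transpose_mat P * B * P)"
proof -
  have "transpose_mat (P * A * transpose_mat P) * B = P * (transpose_mat A * (transpose_mat P * B))"
    using assms by (simp add: transpose_mult[of _ n n _ n] assoc_mult_mat[of _ n n _ n _ n])
  moreover have "mat_trace (P * (transpose_mat A * (transpose_mat P * B))) =
      mat_trace (transpose_mat A * (transpose_mat P * B) * P)"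
    by (rule mat_trace_mult_commute[of _ n n]) (use assms in auto)
  ultimately show ?thesis
    using assms by (simp add: trace_form_def assoc_mult_mat[of _ n n _ n _ n])
qed

lemma congruence_cancel:
  fixes P Q B :: "'a::field mat"
  assumes PQ: "inverse_mats n P Q" and B: "B \<in> carrier_mat n n"
  shows "Q * (P * B * transpose_mat P) * transpose_mat Q = B"
proof -
  have c: "P \<in> carrier_mat n n" "Q \<in> carrier_mat n n" and QP: "Q * P = 1\<^sub>m n"
    using PQ by (auto simp: inverse_mats_def)
  have t: "transpose_mat P * transpose_mat Q = 1\<^sub>m n"
    using inverse_mats_transpose[OF PQ] by (simp add: inverse_mats_def)
  have "Q * (P * B * transpose_mat P) * transpose_mat Q = (Q * P) * B * (transpose_mat P * transpose_mat Q)"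
    using c B by (simp add: assoc_mult_mat[of _ n n _ n _ n])
  then show ?thesis using B by (simp add: QP t)
qed

text \<open>In the trace form \<open>P\<close> moves to the other argument, and congruence by its
  transpose permutes the matrices of rank \<open>r\<close>.\<close>

lemma (in additive_character) alternating_char_sum_congruence:
  assumes PQ: "inverse_mats n P Q" and A: "A \<in> carrier_mat n n"
  shows "alternating_char_sum n (P * A * transpose_mat P) r = alternating_char_sum n A r"
proof -
  have P: "P \<in> carrier_mat n n" and Q: "Q \<in> carrier_mat n n" using PQ by (auto simp: inverse_mats_def)
  note t = inverse_mats_transpose[OF PQ] and t' = inverse_mats_transpose[OF inverse_mats_sym[OF PQ]]
  have step: "transpose_mat R * B * R \<in> alternating_mats_of_rank n r"
    if "inverse_mats n (transpose_mat R) S" "B \<in> alternating_mats_of_rank n r" for R S B :: "'a mat"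
    using that congruence_alternating[of "transpose_mat R" n B] rank_congruence[OF that(1), of B]
    by (auto simp: alternating_mats_of_rank_def inverse_mats_def alternating_mats_carrier)
  show ?thesis
    unfolding alternating_char_sum_def
  proof (rule sum.reindex_bij_witness[of _ "\<lambda>B. transpose_mat Q * B * Q" "\<lambda>B. transpose_mat P * B * P"])
    fix B :: "'a mat" assume B: "B \<in> alternating_mats_of_rank n r"
    then have Bc: "B \<in> carrier_mat n n" by (simp add: alternating_mats_of_rank_def alternating_mats_carrier)
    show "transpose_mat P * B * P \<in> alternating_mats_of_rank n r" using step[OF t B] .
    show "transpose_mat Q * B * Q \<in> alternating_mats_of_rank n r" using step[OF t' B] .
    show "transpose_mat Q * (transpose_mat P * B * P) * Q = B" using congruence_cancel[OF t Bc] by simp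
    show "transpose_mat P * (transpose_mat Q * B * Q) * P = B" using congruence_cancel[OF t' Bc] by simp
    show "\<chi> (trace_form A (transpose_mat P * B * P)) = \<chi> (trace_form (P * A * transpose_mat P) B)"
      using trace_form_congruence[OF P A Bc] by simp
  qed
qed

text \<open>A basis whose first member is \<open>v\<close> gives the columns of an invertible
  \<open>Q\<close> sending the first unit vector to \<open>v\<close>; its inverse is
  \<open>P\<close>.\<close>

lemma exists_mat_to_unit_vec:
  fixes v :: "'a::field vec"
  assumes v: "v \<in> carrier_vec n" "v \<noteq> 0\<^sub>v n"
  obtains P Q where "inverse_mats n P Q" "P *\<^sub>v v = unit_vec n 0"
proof -
  interpret vec_space "TYPE('a)" n .
  note b = basis_completion[OF v]
  define Q where "Q = mat_of_cols n (basis_completion v)"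
  have Q: "Q \<in> carrier_mat n n" and cols: "cols Q = basis_completion v"
    using b by (auto simp: Q_def cols_mat_of_cols)
  have "rank Q = n" using lin_indpt_full_rank[OF Q] b cols by simp
  then have "det Q \<noteq> 0" using det_rank_iff[OF Q] by simp
  from det_non_zero_imp_unit[OF Q this, unfolded Units_def, of "()"]
  obtain P where P: "P \<in> carrier_mat n n" "P * Q = 1\<^sub>m n" "Q * P = 1\<^sub>m n"
    by (auto simp: ring_mat_def)
  have PQ: "inverse_mats n P Q" using P Q by (simp add: inverse_mats_def)
  have n: "n > 0" using v by (cases n) auto
  have "Q *\<^sub>v unit_vec n 0 = col Q 0"
    by (rule eq_vecI) (use Q n in simp_all)
  also have "\<dots> = v" using b(7) cols n Q
    by (metis carrier_matD(2) cols_length cols_nth hd_conv_nth length_0_conv less_numeral_extra(3))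
  finally have "P *\<^sub>v v = unit_vec n 0" using inverse_mats_cancel_vec[OF PQ, of "unit_vec n 0"] by simp
  with PQ show ?thesis by (rule that)
qed

section \<open>Congruences that fix the first coordinate, and the reduction of nonzero
  matrices\<close>

definition one_direct_sum :: "'a::semiring_1 mat \<Rightarrow> 'a mat" where
  "one_direct_sum P = mat (Suc (dim_row P)) (Suc (dim_col P))
     (\<lambda>(i, j). case i of 0 \<Rightarrow> (if j = 0 then 1 else 0)
        | Suc i \<Rightarrow> (case j of 0 \<Rightarrow> 0 | Suc j \<Rightarrow> P $$ (i, j)))"

lemma one_direct_sum_carrier:
  "P \<in> carrier_mat n m \<Longrightarrow> one_direct_sum P \<in> carrier_mat (Suc n) (Suc m)"
  by (simp add: one_direct_sum_def)

lemma row_one_direct_sum: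
  assumes "P \<in> carrier_mat n m"
  shows "row (one_direct_sum P) 0 = vCons 1 (0\<^sub>v m)"
    and "i < n \<Longrightarrow> row (one_direct_sum P) (Suc i) = vCons 0 (row P i)"
  using assms by (auto simp: one_direct_sum_def vec_index_vCons split: nat.split intro!: eq_vecI)

lemma col_one_direct_sum:
  assumes "P \<in> carrier_mat n m"
  shows "col (one_direct_sum P) 0 = vCons 1 (0\<^sub>v n)"
    and "j < m \<Longrightarrow> col (one_direct_sum P) (Suc j) = vCons 0 (col P j)"
  using assms by (auto simp: one_direct_sum_def vec_index_vCons split: nat.split intro!: eq_vecI)

lemma one_direct_sum_index:
  "one_direct_sum P $$ (0, 0) = 1"
  "j < dim_col P \<Longrightarrow> one_direct_sum P $$ (0, Suc j) = 0"
  "i < dim_row P \<Longrightarrow> one_direct_sum P $$ (Suc i, 0) = 0"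
  "i < dim_row P \<Longrightarrow> j < dim_col P \<Longrightarrow> one_direct_sum P $$ (Suc i, Suc j) = P $$ (i, j)"
  by (simp_all add: one_direct_sum_def)

lemma one_direct_sum_mult:
  fixes P Q :: "'a::comm_ring_1 mat"
  assumes P: "P \<in> carrier_mat n m" and Q: "Q \<in> carrier_mat m k"
  shows "one_direct_sum P * one_direct_sum Q = one_direct_sum (P * Q)"
proof (rule eq_matI)
  fix i j assume "i < dim_row (one_direct_sum (P * Q))" "j < dim_col (one_direct_sum (P * Q))"
  then have ij: "i < Suc n" "j < Suc k" using P Q by (simp_all add: one_direct_sum_def)
  have "(one_direct_sum P * one_direct_sum Q) $$ (i, j) = row (one_direct_sum P) i \<bullet> col (one_direct_sum Q) j"
    using ij one_direct_sum_carrier[OF P] one_direct_sum_carrier[OF Q] by simp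
  also have "\<dots> = one_direct_sum (P * Q) $$ (i, j)"
    using ij P Q
    by (cases i; cases j) (simp_all add: row_one_direct_sum[OF P] col_one_direct_sum[OF Q] one_direct_sum_index)
  finally show "(one_direct_sum P * one_direct_sum Q) $$ (i, j) = one_direct_sum (P * Q) $$ (i, j)" .
qed (use P Q in \<open>simp_all add: one_direct_sum_def\<close>)

lemma one_direct_sum_one: "one_direct_sum (1\<^sub>m n) = 1\<^sub>m (Suc n)"
  by (rule eq_matI) (auto simp: one_direct_sum_def split: nat.split)

lemma inverse_mats_one_direct_sum:
  fixes P Q :: "'a::comm_ring_1 mat"
  assumes "inverse_mats n P Q"
  shows "inverse_mats (Suc n) (one_direct_sum P) (one_direct_sum Q)"
  using assms unfolding inverse_mats_def
  by (auto simp: one_direct_sum_mult[of _ n n _ n] one_direct_sum_one one_direct_sum_carrier)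

lemma bordered_mat_congruence:
  fixes P :: "'a::field mat"
  assumes P: "P \<in> carrier_mat n n" and a: "a \<in> carrier_vec n" and A: "A \<in> carrier_mat n n"
  shows "one_direct_sum P * bordered_mat a A * transpose_mat (one_direct_sum P) =
    bordered_mat (P *\<^sub>v a) (P * A * transpose_mat P)"
proof (rule eq_matI)
  note c = one_direct_sum_carrier[OF P] bordered_mat_carrier[OF a, of A]
  fix i j
  assume "i < dim_row (bordered_mat (P *\<^sub>v a) (P * A * transpose_mat P))"
    "j < dim_col (bordered_mat (P *\<^sub>v a) (P * A * transpose_mat P))"
  then have ij: "i < Suc n" "j < Suc n" using P by (simp_all add: bordered_mat_def)
  have r: "row P k \<in> carrier_vec n" if "k < n" for k using P that by simp
  have A0: "A *\<^sub>v 0\<^sub>v n = 0\<^sub>v n" by (rule eq_vecI) (use A in auto)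
  have C: "bordered_mat b (P * A * transpose_mat P) $$ (Suc k, Suc l) = row P k \<bullet> (A *\<^sub>v row P l)"
    if "k < n" "l < n" "dim_vec b = n" for k l b
    unfolding congruence_index[OF P A that(1,2), symmetric] using that by (simp add: bordered_mat_def)
  show "(one_direct_sum P * bordered_mat a A * transpose_mat (one_direct_sum P)) $$ (i, j) =
      bordered_mat (P *\<^sub>v a) (P * A * transpose_mat P) $$ (i, j)"
    unfolding congruence_index[OF c ij]
  proof (cases i)
    case 0
    show "row (one_direct_sum P) i \<bullet> (bordered_mat a A *\<^sub>v row (one_direct_sum P) j) =
        bordered_mat (P *\<^sub>v a) (P * A * transpose_mat P) $$ (i, j)"
    proof (cases j)
      case (Suc l)
      then show ?thesis using 0 ij P a A r comm_scalar_prod[OF a r]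
        by (simp add: row_one_direct_sum[OF P] bordered_mat_mult_vec[OF a A] bordered_mat_def[of "P *\<^sub>v a"])
    qed (use 0 P a A A0 in \<open>simp add: row_one_direct_sum[OF P] bordered_mat_mult_vec[OF a A] bordered_mat_def[of "P *\<^sub>v a"]\<close>)
  next
    case (Suc k)
    show "row (one_direct_sum P) i \<bullet> (bordered_mat a A *\<^sub>v row (one_direct_sum P) j) =
        bordered_mat (P *\<^sub>v a) (P * A * transpose_mat P) $$ (i, j)"
    proof (cases j)
      case 0
      then show ?thesis using Suc ij P a A A0
        by (simp add: row_one_direct_sum[OF P] bordered_mat_mult_vec[OF a A] bordered_mat_def[of "P *\<^sub>v a"])
    next
      case (Suc l)
      have z: "0 \<cdot>\<^sub>v a + A *\<^sub>v row P l = A *\<^sub>v row P l" by (rule eq_vecI) (use a A in auto)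
      have kl: "k < n" "l < n" using Suc \<open>i = Suc k\<close> ij by simp_all
      have d: "dim_vec (P *\<^sub>v a) = n" using P by simp
      show ?thesis unfolding Suc \<open>i = Suc k\<close> C[OF kl d] using kl r z
        by (simp add: row_one_direct_sum[OF P] bordered_mat_mult_vec[OF a A])
    qed
  qed
qed (use P a A in \<open>simp_all add: bordered_mat_def one_direct_sum_def\<close>)

lemma of_nat_CARD_power_neq_1:
  assumes "k > 0"
  shows "(of_nat CARD('a::{finite, field}) :: complex) ^ k \<noteq> 1"
proof
  assume "(of_nat CARD('a) :: complex) ^ k = 1"
  then have "CARD('a) ^ k = 1" by (metis of_nat_1 of_nat_eq_iff of_nat_power)
  then show False using assms two_le_CARD[where 'a = 'a] by simp
qed

text \<open>Translation by 1 permutes the field. Comparing the sums of all elements gives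
  \<open>of_nat CARD('a) = 0\<close>, which for odd order is incompatible with
  \<open>2 = 0\<close>.\<close>

lemma two_neq_0_if_odd_CARD:
  assumes "odd CARD('a::{finite, field})"
  shows "(2 :: 'a) \<noteq> 0"
proof
  assume two: "(2 :: 'a) = 0"
  have "(\<Sum>x\<in>UNIV. x) = (\<Sum>x\<in>UNIV. x + 1 :: 'a)"
    by (rule sum.reindex_bij_witness[of _ "\<lambda>x. x + 1" "\<lambda>x. x - 1"]) auto
  then have "(of_nat CARD('a) :: 'a) = 0" by (simp add: sum.distrib)
  moreover obtain k where "CARD('a) = 2 * k + 1" using assms by (rule oddE)
  ultimately show False using two by simp
qed

text \<open>Each double bordering by a unit vector raises the rank by 2. Existence is what gives the
  definite description in \<open>canonical_matrix_Alt\<close> a unique value.\<close>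

lemma exists_alternating_mat_of_rank:
  assumes "2 * y \<le> n"
  shows "alternating_mats_of_rank n (2 * y) \<noteq> ({} :: 'a::{finite, field} mat set)"
  using assms
proof (induction y arbitrary: n)
  case 0
  show ?case
    using zero_mat_alternating[of n] rank_0_iff[of "0\<^sub>m n n :: 'a mat" n n]
    by (auto simp: alternating_mats_of_rank_def)
next
  case (Suc y)
  then obtain m where n: "n = Suc (Suc m)" and m: "2 * y \<le> m"
    by (metis add_2_eq_Suc le_Suc_ex mult_Suc_right add.assoc le_add1)
  obtain A :: "'a mat" where A: "A \<in> alternating_mats_of_rank m (2 * y)" using Suc.IH[OF m] by blast
  have "bordered_mat (unit_vec (Suc m) 0) (bordered_mat (0\<^sub>v m) A) \<in> alternating_mats_of_rank n (2 * Suc y)"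
    using A by (simp add: n alternating_mats_of_rank_def bordered_mat_alternating rank_bordered_mat_unit)
  then show ?case by blast
qed

text \<open>The first congruence moves a nonzero column to the front; the second fixes the first
  coordinate and turns the resulting border into the first unit vector. The vector \<open>a\<close>
  can stay arbitrary, since neither the rank nor the character sum depends on it.\<close>

lemma alternating_mat_reduction:
  fixes A :: "'a::field mat"
  assumes A: "A \<in> alternating_mats n" and "A \<noteq> 0\<^sub>m n n"
  obtains m a B P Q P' Q' where "n = Suc (Suc m)" "a \<in> carrier_vec m" "B \<in> alternating_mats m"
    "inverse_mats n P Q" "inverse_mats n P' Q'"
    "P' * (P * A * transpose_mat P) * transpose_mat P' = bordered_mat (unit_vec (Suc m) 0) (bordered_mat a B)"
proof -
  note Ac = alternating_mats_carrier[OF A]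
  obtain i j where ij: "i < n" "j < n" "A $$ (i, j) \<noteq> 0"
    using assms(2) Ac by (auto simp: mat_eq_iff)
  have e: "unit_vec n j \<in> carrier_vec n" "unit_vec n j \<noteq> (0\<^sub>v n :: 'a vec)"
    using ij by (auto simp: vec_eq_iff)
  obtain R S where RS: "inverse_mats n R S" "R *\<^sub>v unit_vec n j = (unit_vec n 0 :: 'a vec)"
    by (rule exists_mat_to_unit_vec[OF e])
  \<comment> \<open>Then the transpose of \<open>P\<close> is \<open>S\<close>, which sends the
    first unit vector to the \<open>j\<close>-th one, so the first column of \<open>M\<close> is
    \<open>P\<close> applied to the nonzero column \<open>j\<close> of \<open>A\<close>.\<close>
  define P Q where "P = transpose_mat S" "Q = transpose_mat R"
  have PQ: "inverse_mats n P Q"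
    unfolding P_Q_def by (rule inverse_mats_transpose[OF inverse_mats_sym[OF RS(1)]])
  have P: "P \<in> carrier_mat n n" and S: "S \<in> carrier_mat n n" using PQ RS by (simp_all add: inverse_mats_def)
  define M where "M = P * A * transpose_mat P"
  have M: "M \<in> alternating_mats n" unfolding M_def by (rule congruence_alternating[OF P A])
  obtain k where n: "n = Suc k" using ij by (cases n) auto
  obtain b C where bC: "b \<in> carrier_vec k" "C \<in> alternating_mats k" "M = bordered_mat b C"
    using M unfolding n by (rule alternating_mats_Suc_cases)
  have "S *\<^sub>v unit_vec n 0 = (unit_vec n j :: 'a vec)"
    using inverse_mats_cancel_vec[OF inverse_mats_sym[OF RS(1)] e(1)] RS(2) by simp
  then have "M *\<^sub>v unit_vec n 0 = P *\<^sub>v (A *\<^sub>v unit_vec n j)"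
    unfolding M_def congruence_mult_vec[OF P Ac unit_vec_carrier] by (simp add: P_Q_def)
  moreover have "(A *\<^sub>v unit_vec n j) $ i \<noteq> 0" using ij Ac by simp
  then have "A *\<^sub>v unit_vec n j \<noteq> 0\<^sub>v n" using ij by force
  moreover have "Q *\<^sub>v (P *\<^sub>v (A *\<^sub>v unit_vec n j)) = A *\<^sub>v unit_vec n j"
    by (rule inverse_mats_cancel_vec[OF inverse_mats_sym[OF PQ]]) (use Ac in simp)
  moreover have "Q *\<^sub>v 0\<^sub>v n = 0\<^sub>v n" by (rule eq_vecI) (use PQ in \<open>auto simp: inverse_mats_def\<close>)
  ultimately have M0: "M *\<^sub>v unit_vec n 0 \<noteq> 0\<^sub>v n" by metis
  have "b \<noteq> 0\<^sub>v k"
  proof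
    assume b0: "b = 0\<^sub>v k"
    have "1 \<cdot>\<^sub>v b + C *\<^sub>v 0\<^sub>v k = 0\<^sub>v k"
      unfolding b0 by (rule eq_vecI) (use alternating_mats_carrier[OF bC(2)] in auto)
    then show False
      using M0 unfolding bC(3) n unit_vec_Suc_0
        bordered_mat_mult_vec[OF bC(1) alternating_mats_carrier[OF bC(2)] zero_carrier_vec]
      using b0 by (simp add: zero_vec_Suc)
  qed
  then obtain U V where UV: "inverse_mats k U V" "U *\<^sub>v b = unit_vec k 0"
    using exists_mat_to_unit_vec[OF bC(1)] by blast
  obtain m where k: "k = Suc m" using \<open>b \<noteq> 0\<^sub>v k\<close> bC(1) by (cases k) auto
  have U: "U \<in> carrier_mat k k" using UV by (simp add: inverse_mats_def)
  have "U * C * transpose_mat U \<in> alternating_mats (Suc m)"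
    using congruence_alternating[OF U bC(2)] by (simp add: k)
  then obtain a B where aB: "a \<in> carrier_vec m" "B \<in> alternating_mats m" "U * C * transpose_mat U = bordered_mat a B"
    by (rule alternating_mats_Suc_cases)
  have "one_direct_sum U * (P * A * transpose_mat P) * transpose_mat (one_direct_sum U) =
      bordered_mat (unit_vec (Suc m) 0) (bordered_mat a B)"
    unfolding M_def[symmetric] bC(3) bordered_mat_congruence[OF U bC(1) alternating_mats_carrier[OF bC(2)]] UV(2) aB(3) k ..
  moreover have "inverse_mats n (one_direct_sum U) (one_direct_sum V)"
    unfolding n by (rule inverse_mats_one_direct_sum[OF UV(1)])
  ultimately show ?thesis using that PQ aB n k by blast
qed

subsection \<open>Evaluation of the character sums\<close>

context additive_character
begin

text \<open>The zero matrix is the zero matrix of one size less with zero border, so the sums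
  satisfy the recursion \<open>alt_count_mult\<close>.\<close>

lemma alternating_char_sum_zero_mat:
  assumes two: "(2 :: 'a) \<noteq> 0"
  shows "alternating_char_sum n (0\<^sub>m n n) (2 * x) = alt_count (of_nat CARD('a)) (of_nat CARD('a) ^ n) x"
proof (induction n arbitrary: x)
  case 0
  show ?case
  proof (cases x)
    case (Suc x')
    have "alternating_mats_of_rank 0 (2 * x) = ({} :: 'a mat set)"
      using rank_0_iff[of "0\<^sub>m 0 0 :: 'a mat" 0 0] Suc
      by (auto simp: alternating_mats_of_rank_def alternating_mats_0)
    \<comment> \<open>For size 0 the variable \<open>X\<close> is 1, and the product contains
      \<open>1 - q ^ 0\<close>.\<close>
    moreover have "alt_count (of_nat CARD('a)) (1 :: complex) x = 0"
      unfolding alt_count_def Suc by (simp add: prod.lessThan_Suc_shift del: prod.lessThan_Suc)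
    ultimately show ?thesis by (simp add: alternating_char_sum_def)
  qed (simp add: alternating_char_sum_rank_0)
next
  case (Suc n)
  let ?q = "of_nat CARD('a) :: complex"
  show ?case
  proof (cases x)
    case (Suc x')
    have z: "0\<^sub>m (Suc n) (Suc n) = bordered_mat (0\<^sub>v n) (0\<^sub>m n n :: 'a mat)"
      by (rule eq_matI) (auto simp: bordered_mat_def split: nat.split)
    have d: "2 * Suc x' = Suc (Suc (2 * x'))" by simp
    have "alternating_char_sum (Suc n) (0\<^sub>m (Suc n) (Suc n)) (2 * Suc x') =
       ?q ^ (2 * x' + 2) * alternating_char_sum n (0\<^sub>m n n) (2 * Suc x') +
       (?q ^ n - ?q ^ (2 * x')) * alternating_char_sum n (0\<^sub>m n n) (2 * x')"
      unfolding z d using alternating_char_sum_bordered_mat_zero[OF two zero_mat_alternating, of n "2 * x'"] by simp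
    also have "\<dots> = alt_count ?q (?q * ?q ^ n) (Suc x')"
      unfolding Suc.IH by (rule alt_count_mult[symmetric]) (simp_all add: of_nat_CARD_power_neq_1)
    finally show ?thesis by (simp add: Suc)
  qed (simp add: alternating_char_sum_rank_0)
qed

text \<open>Strong induction, as the reduction of a nonzero \<open>A\<close> lowers the size by 2
  and \<open>y\<close> by 1; the resulting recursion is \<open>alt_sum_Suc\<close>.\<close>

lemma alternating_char_sum_eq_alt_sum:
  assumes two: "(2 :: 'a) \<noteq> 0" and "A \<in> alternating_mats_of_rank n (2 * y)"
  shows "alternating_char_sum n A (2 * x) = alt_sum (of_nat CARD('a)) y (of_nat CARD('a) ^ n) x"
  using assms(2)
proof (induction n arbitrary: A x y rule: less_induct)
  case (less n)
  let ?q = "of_nat CARD('a) :: complex"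
  have A: "A \<in> alternating_mats n" and r: "vec_space.rank n A = 2 * y"
    using less.prems by (auto simp: alternating_mats_of_rank_def)
  note Ac = alternating_mats_carrier[OF A]
  show ?case
  proof (cases "A = 0\<^sub>m n n")
    case True
    then have "y = 0" using r rank_0_iff[OF Ac] by simp
    then show ?thesis using True alternating_char_sum_zero_mat[OF two] by simp
  next
    case False
    obtain m a B P Q P' Q' where red: "n = Suc (Suc m)" "a \<in> carrier_vec m" "B \<in> alternating_mats m"
      "inverse_mats n P Q" "inverse_mats n P' Q'"
      "P' * (P * A * transpose_mat P) * transpose_mat P' = bordered_mat (unit_vec (Suc m) 0) (bordered_mat a B)"
      by (rule alternating_mat_reduction[OF A False])
    let ?M = "bordered_mat (unit_vec (Suc m) 0) (bordered_mat a B)"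
    have c: "P * A * transpose_mat P \<in> carrier_mat n n"
      using red(4) Ac by (simp add: inverse_mats_def)
    have "vec_space.rank n ?M = vec_space.rank n A"
      unfolding red(6)[symmetric] rank_congruence[OF red(5) c] rank_congruence[OF red(4) Ac] ..
    then obtain y' where y: "y = Suc y'" and rB: "vec_space.rank m B = 2 * y'"
      using r rank_bordered_mat_unit[OF red(2,3)] unfolding red(1) by (cases y) auto
    have sum: "alternating_char_sum n A k = alternating_char_sum n ?M k" for k
      unfolding red(6)[symmetric] alternating_char_sum_congruence[OF red(5) c]
        alternating_char_sum_congruence[OF red(4) Ac] ..
    have IH: "alternating_char_sum m B (2 * x) = alt_sum ?q y' (?q ^ m) x" for x
      using less.IH[of m B y'] red rB by (simp add: alternating_mats_of_rank_def)
    show ?thesis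
    proof (cases x)
      case 0
      then show ?thesis by (simp add: alternating_char_sum_rank_0[OF Ac])
    next
      case (Suc x')
      have d: "2 * Suc x' = Suc (Suc (2 * x'))" by simp
      have "alternating_char_sum n A (2 * Suc x') =
          ?q ^ (2 * x' + 2) * alternating_char_sum m B (2 * Suc x') - ?q ^ (2 * x') * alternating_char_sum m B (2 * x')"
        unfolding sum d unfolding red(1) using alternating_char_sum_bordered_mat_unit[OF two red(2,3)] by simp
      also have "\<dots> = alt_sum ?q (Suc y') (?q\<^sup>2 * ?q ^ m) (Suc x')"
        unfolding IH by (rule alt_sum_Suc[symmetric]) (simp_all add: of_nat_CARD_power_neq_1)
      finally show ?thesis by (simp add: Suc y red(1) power2_eq_square mult.assoc)
    qed
  qed
qed

end

section \<open>The canonical matrix in closed form\<close>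

lemma krawtchouk_sum:
  "(\<Sum>k\<le>y. q_pochhammer (inverse (q\<^sup>2) ^ y) (q\<^sup>2) k * krawtchouk_term q N Y x k) =
     (-1) ^ x * q ^ (x * (x - 1)) * q_pochhammer Y (q powi (-2)) x * gaussian_poly N x (q\<^sup>2) *
     affine_q_krawtchouk y x (inverse Y) N (q\<^sup>2)"
proof -
  have p: "(q\<^sup>2) powi (- int k) = inverse (q\<^sup>2) ^ k" for k
    by (simp add: power_int_minus power_inverse)
  have m: "q powi (-2) = inverse (q\<^sup>2)" by (simp add: power_int_minus)
  show ?thesis
    unfolding affine_q_krawtchouk_def krawtchouk_term_def p m sum_distrib_left
    by (rule sum.cong) simp_all
qed

lemma canonical_matrix_Alt_eq_alt_sum:
  fixes \<theta> :: "'a::{finite, field} \<Rightarrow> complex"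
  assumes "odd CARD('a)" and \<theta>: "nontrivial_additive_character \<theta>" and "2 * y \<le> n"
  shows "canonical_matrix_Alt \<theta> n (2 * y) (2 * x) = alt_sum (of_nat CARD('a)) y (of_nat CARD('a) ^ n) x"
proof -
  have "cnj u \<noteq> 1" if "u \<noteq> 1" for u using that by (metis complex_cnj_cnj complex_cnj_one)
  \<comment> \<open>The entries are sums of conjugated values, and the conjugate is again a
    nontrivial additive character.\<close>
  then interpret additive_character "\<lambda>u. cnj (\<theta> u)"
    using \<theta> by unfold_locales (auto simp: nontrivial_additive_character_def)
  have "(\<Sum>B\<in>alternating_mats_of_rank n (2 * x). cnj (\<theta> (trace_form A B))) =
      alt_sum (of_nat CARD('a)) y (of_nat CARD('a) ^ n) x"
    if "A \<in> alternating_mats_of_rank n (2 * y)" for A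
    using alternating_char_sum_eq_alt_sum[OF two_neq_0_if_odd_CARD[OF assms(1)] that]
    by (simp add: alternating_char_sum_def)
  then show ?thesis
    unfolding canonical_matrix_Alt_def
    using exists_alternating_mat_of_rank[OF assms(3), where 'a = 'a] by (intro the_equality) auto
qed

theorem proposition5p3p2:
  fixes \<theta> :: "'a::{finite, field} \<Rightarrow> complex"
    and q :: complex and N x y :: nat
  assumes "odd CARD('a)"
    and "q = of_nat CARD('a)"
    and "nontrivial_additive_character \<theta>"
    and "x \<le> N" and "y \<le> N"
  shows "canonical_matrix_Alt \<theta> (2 * N) (2 * y) (2 * x) =
           (-1) ^ x * q ^ (x * (x - 1)) * q_pochhammer (q powi (2 * int N - 1)) (q powi (-2)) x *
           gaussian_poly N x (q\<^sup>2) *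
           affine_q_krawtchouk y x (q powi (- 2 * int N + 1)) N (q\<^sup>2)
         \<and> canonical_matrix_Alt \<theta> (2 * N + 1) (2 * y) (2 * x) =
           (-1) ^ x * q ^ (x * (x - 1)) * q_pochhammer (q powi (2 * int N + 1)) (q powi (-2)) x *
           gaussian_poly N x (q\<^sup>2) *
           affine_q_krawtchouk y x (q powi (- 2 * int N - 1)) N (q\<^sup>2)"
proof -
  have q0: "q \<noteq> 0" and q1: "\<And>k. k > 0 \<Longrightarrow> q ^ k \<noteq> 1"
    using of_nat_CARD_power_neq_1[where 'a = 'a] by (simp_all add: assms(2))
  \<comment> \<open>Both formulas are instances: \<open>Y\<close> is \<open>q ^ n / q\<close> for
    \<open>n = 2 * N\<close> and \<open>q ^ n\<close> for \<open>n = 2 * N + 1\<close>, and the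
    Krawtchouk parameter is its inverse.\<close>
  have eq: "canonical_matrix_Alt \<theta> n (2 * y) (2 * x) =
      (-1) ^ x * q ^ (x * (x - 1)) * q_pochhammer Y (q powi (-2)) x * gaussian_poly N x (q\<^sup>2) *
      affine_q_krawtchouk y x (inverse Y) N (q\<^sup>2)"
    if "q ^ n = (q\<^sup>2) ^ N \<and> Y = q ^ n / q \<or> q ^ n = q * (q\<^sup>2) ^ N \<and> Y = q ^ n" "2 * y \<le> n" for n Y
    using canonical_matrix_Alt_eq_alt_sum[OF assms(1,3) that(2)]
      alt_sum_eq_krawtchouk_sum[OF q0 q1 that(1) assms(4,5)]
    by (simp add: krawtchouk_sum assms(2))
  have inv: "q powi (- 2 * int N + 1) = inverse (q powi (2 * int N - 1))"
    "q powi (- 2 * int N - 1) = inverse (q powi (2 * int N + 1))"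
    unfolding power_int_minus[symmetric] by simp_all
  have e: "q powi (2 * int N) = q ^ (2 * N)"
    by (metis of_nat_mult of_nat_numeral power_int_of_nat)
  have "q powi (2 * int N - 1) = q ^ (2 * N) / q" "q powi (2 * int N + 1) = q ^ (2 * N + 1)"
    using q0 by (simp_all add: power_int_diff power_int_add e)
  then show ?thesis
    unfolding inv using assms(5) by (intro conjI eq) (simp_all add: power_mult)
qed

end
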